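(* Let $x_*$ be a locally optimal solution of the problem $(\mathcal{P})$, let the functions $f_k$, $k\in M$, and $G$ be twice Fréchet differentiable at $x_*$, and let $(x_*,\mu_* )$ be a KKT-pair of $(\mathcal{P})$ satisfying the second order sufficient optimality condition. Suppose also that assumptions (A2), (A4), (A10) and (A11) listed in the context hold true, and that the function $\Phi(G(x),\lambda,c)$ admits the second order expansion in $x$ at $(x_*,\lambda_* )$ for some $\lambda_*\in\Phi_0^{-1}(\mu_* )$. Then $(x_*,\lambda_* )$ is a local saddle point of $\mathscr{L}(x,\lambda,c)$.
   Context: Setting. $X=\mathbb{R}^d$, $A\subseteq X$ is a nonempty convex set, $Y$ is a normed space with dual $Y^*$ and pairing $\langle\cdot,\cdot\rangle$, $K\subseteq Y$ is a nonempty closed convex cone, $K^*=\{y^*\in Y^*\mid\langle y^*,y\rangle\le 0\ \forall y\in K\}$. $f=\max_{k\in M}f_k$ with $M=\{1,\dots,m\}$, $f_k:\mathbb{R}^d\to\mathbb{R}\cup\{+\infty\}$, and $G:X\to Y$. Problem $(\mathcal{P})$: minimize $f(x)$ subject to $G(x)\in K$, $x\in A$; there is a feasible point with $f(x)<+\infty$ and a globally optimal solution exists. $\Lambda\subseteq Y^*$ is a given closed convex cone. $\Phi:Y\times Y^*\times(0,+\infty)\to\mathbb{R}\cup\{+\infty\}$, and $\mathscr{L}(x,\lambda,c)=f(x)+\Phi(G(x),\lambda,c)$. Assumptions: (A2) $\Phi(y,\lambda,c)\le 0$ for all $y\in K$, $\lambda\in\Lambda$, $c>0$. (A4) $c\mapsto\Phi(y,\lambda,c)$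 is non-decreasing for all $y\in Y$, $\lambda\in\Lambda$. (A10) $\Phi(y,\lambda,c)=0$ for all $y\in K$, $\lambda\in K^*$, $c>0$ with $\langle\lambda,y\rangle=0$. (A11) for all $y\in K$, $\lambda\in K^*$, $c>0$ with $\langle\lambda,y\rangle=0$ the function $\Phi(\cdot,\lambda,c)$ is Fréchet differentiable at $y$ with $D_y\Phi(y,\lambda,c)=\Phi_0(\lambda)$, where $\Phi_0:K^*\to K^*$ is a surjective mapping not depending on $y$ and $c$ such that $\langle\Phi_0(\lambda),y\rangle=0$ iff $\langle\lambda,y\rangle=0$. Local saddle point: $(x_*,\lambda_* )\in A\times\Lambda$ such that for some $c_0>0$ and a neighbourhood $U$ of $x_*$, for all $c\ge c_0$: $\mathscr{L}(x_*,\lambda_*,c)<+\infty$ and $\sup_{\lambda\in\Lambda}\mathscr{L}(x_*,\lambda,c)\le\mathscr{L}(x_*,\lambda_*,c)\le\inf_{x\in U\cap A}\mathscr{L}(x,\lambda_*,c)$. KKT notions. $L(x,\lambda)=f(x)+\langle\lambda,G(x)\rangle$; $L_0(x,\lambda,\alpha)=\sum_{k=1}^m\alpha_kf_k(x)+\langle\lambda,G(x)\rangle$; $M(x)=\{k\in M\mid f_k(x)=f(x)\}$; $T_A(x)$, $T_K(y)$ are contingent cones; $[L(\cdot,\lambda)]'(x,h)$ is the directional derivative. $(x_*,\mu_* )$ with $x_*\in A$ is a KKT-pair if $G(x_* )\in K$, $\mu_*\in K^*$, $\langle\mu_*,G(x_* )\rangle=0$ and $[L(\cdot,\mu_* )]'(x_*,h)\ge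 0$ for all $h\in T_A(x_* )$. $\alpha(x_*,\mu_* )$ is the set of $\alpha\in\mathbb{R}^m_+$ with $\alpha_k=0$ for $k\notin M(x_* )$, $\sum_k\alpha_k=1$ and $\langle D_xL_0(x_*,\mu_*,\alpha),h\rangle\ge 0$ for all $h\in T_A(x_* )$. The critical cone is $C(x_*,\mu_* )=\{h\in T_A(x_* )\mid DG(x_* )h\in T_K(G(x_* )),\ \langle\mu_*,DG(x_* )h\rangle=0\}$. $\mathcal{T}(h)=T_K^2(G(x_* ),DG(x_* )h)$, where $T^2_K(y,v)=\{w\mid\exists t_n\downarrow 0:\ \mathrm{dist}(y+t_nv+\tfrac12t_n^2w,K)=o(t_n^2)\}$ is the outer second order tangent set, and $\sigma(\mu,\mathcal{T}(h))=\sup_{y\in\mathcal{T}(h)}\langle\mu,y\rangle$. Second order sufficient optimality condition for a KKT-pair $(x_*,\mu_* )$: $\sup_{\alpha\in\alpha(x_*,\mu_* )}\langle h,D^2_{xx}L_0(x_*,\mu_*,\alpha)h\rangle-\sigma(\mu_*,\mathcal{T}(h))>0$ for all $h\in C(x_*,\mu_* )\setminus\{0\}$ with $[L(\cdot,\mu_* )]'(x_*,h)=0$. Second order expansion in $x$. Let (A11) hold, $G$ be twice Fréchet differentiable at a feasible point $x_*$, $\lambda_*\in K^*$, $\langle\lambda_*,G(x_* )\rangle=0$, $\mu_*=\Phi_0(\lambda_* )$. $\Phi(G(x),\lambda,c)$ admits the second order expansion in $x$ at $(x_*,\lambda_* )$ if for every $c>0$ there is a positively homogeneous of degree $2$ function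 $\omega_c:X\to\mathbb{R}$ such that for any $h$ in a neighbourhood of zero and $c>0$, $\Phi(G(x_*+h),\lambda_*,c)-\Phi(G(x_* ),\lambda_*,c)=\langle\mu_*,DG(x_* )h\rangle+\tfrac12\langle\mu_*,D^2G(x_* )(h,h)\rangle+\tfrac12\omega_c(h)+o(\|h\|^2)$, where $o(\|h\|^2)/\|h\|^2\to 0$ as $h\to 0$, and: (i) $\omega_c(h)\to-\sigma(\mu_*,\mathcal{T}(h))$ as $c\to+\infty$ for any $h\in C(x_*,\mu_* )$; (ii) if the joint upper limit $\limsup_{[h,c]\to[h_*,+\infty]}\omega_c(h)$ (as $h\to h_*$ and $c\to+\infty$) is finite for some $h_*\in T_A(x_* )$, then $h_*\in C(x_*,\mu_* )$ and $\limsup_{[h,c]\to[h_*,+\infty]}\omega_c(h)\ge-\sigma(\mu_*,\mathcal{T}(h_* ))$.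
   Formalization: Condition (ii) of the second order expansion is required along every pair of sequences h_n→h_*, c_n→+∞, since with the single joint upper limit the claim is false (f=−|x|², G=id, K={0}, Φ=⟨λ,y⟩+(c/2)y_1² on ℝ²); also λ_*∈Λ is assumed, as a saddle point requires. *)

theory Defs
  imports "HOL-Analysis.Analysis"
begin

text \<open>
  Functions with values in \<open>\<real> \<union> {+\<infinity>}\<close> have type \<^typ>\<open>ereal\<close>, with the value \<open>-\<infinity>\<close> excluded
  by hypothesis.  The dual of a normed space \<open>'y\<close> is \<open>'y \<Rightarrow>\<^sub>L real\<close>, normed by the operator norm.
\<close>

subsection \<open>Derivatives\<close>

definition deriv1 ::
    "('a::real_normed_vector \<Rightarrow> 'b::real_normed_vector) \<Rightarrow> 'a \<Rightarrow> ('a \<Rightarrow>\<^sub>L 'b)" where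
  "deriv1 g x = Blinfun (frechet_derivative g (at x))"

definition deriv2 ::
    "('a::real_normed_vector \<Rightarrow> 'b::real_normed_vector) \<Rightarrow> 'a \<Rightarrow> 'a \<Rightarrow> 'a \<Rightarrow> 'b" where
  "deriv2 g x h k = blinfun_apply (frechet_derivative (deriv1 g) (at x) h) k"

definition twice_frechet_differentiable ::
    "('a::real_normed_vector \<Rightarrow> 'b::real_normed_vector) \<Rightarrow> 'a \<Rightarrow> bool" where
  "twice_frechet_differentiable g x \<longleftrightarrow>
     (\<forall>\<^sub>F z in nhds x. g differentiable (at z)) \<and> deriv1 g differentiable (at x)"

text \<open>
  An extended-real-valued function can be differentiable at a point only if it is finite near
  that point; \<^const>\<open>real_of_ereal\<close> maps infinite values to \<open>0\<close>, so finiteness is stated separately.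
\<close>

definition finite_near :: "('a::topological_space \<Rightarrow> ereal) \<Rightarrow> 'a \<Rightarrow> bool" where
  "finite_near p x \<longleftrightarrow> (\<forall>\<^sub>F z in nhds x. \<bar>p z\<bar> \<noteq> \<infinity>)"

definition has_frechet_deriv_ereal ::
    "('a::real_normed_vector \<Rightarrow> ereal) \<Rightarrow> ('a \<Rightarrow>\<^sub>L real) \<Rightarrow> 'a \<Rightarrow> bool" where
  "has_frechet_deriv_ereal p D x \<longleftrightarrow>
     finite_near p x \<and> ((\<lambda>z. real_of_ereal (p z)) has_derivative blinfun_apply D) (at x)"

definition twice_frechet_differentiable_ereal ::
    "('a::real_normed_vector \<Rightarrow> ereal) \<Rightarrow> 'a \<Rightarrow> bool" where
  "twice_frechet_differentiable_ereal p x \<longleftrightarrow>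
     finite_near p x \<and> twice_frechet_differentiable (\<lambda>z. real_of_ereal (p z)) x"

definition has_directional_deriv ::
    "('a::real_normed_vector \<Rightarrow> ereal) \<Rightarrow> 'a \<Rightarrow> 'a \<Rightarrow> ereal \<Rightarrow> bool" where
  "has_directional_deriv p x h d \<longleftrightarrow>
     ((\<lambda>t. (p (x + t *\<^sub>R h) - p x) / ereal t) \<longlongrightarrow> d) (at_right 0)"


subsection \<open>Cones and tangent sets\<close>

definition polar_cone :: "'y::real_normed_vector set \<Rightarrow> ('y \<Rightarrow>\<^sub>L real) set" where
  "polar_cone K = {l. \<forall>y\<in>K. blinfun_apply l y \<le> 0}"

definition contingent_cone :: "'a::real_normed_vector set \<Rightarrow> 'a \<Rightarrow> 'a set" where
  "contingent_cone S x =
     {h. \<exists>t hs. (\<forall>n. t n > (0::real)) \<and> t \<longlonglongrightarrow> 0 \<and> hs \<longlonglongrightarrow> h \<and> (\<forall>n::nat. x + t n *\<^sub>R hs n \<in> S)}"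

definition outer_second_tangent :: "'y::real_normed_vector set \<Rightarrow> 'y \<Rightarrow> 'y \<Rightarrow> 'y set" where
  "outer_second_tangent K y v =
     {w. \<exists>t. (\<forall>n::nat. t n > (0::real)) \<and> t \<longlonglongrightarrow> 0 \<and>
         (\<lambda>n. infdist (y + t n *\<^sub>R v + ((t n)\<^sup>2 / 2) *\<^sub>R w) K / (t n)\<^sup>2) \<longlonglongrightarrow> 0}"

text \<open>The support function of the empty set is \<open>-\<infinity>\<close>.\<close>

definition support_fun :: "('y::real_normed_vector \<Rightarrow>\<^sub>L real) \<Rightarrow> 'y set \<Rightarrow> ereal" where
  "support_fun l S = (SUP y\<in>S. ereal (blinfun_apply l y))"


subsection \<open>The minimax problem and its Lagrangians\<close>

definition max_fun :: "nat \<Rightarrow> (nat \<Rightarrow> 'x \<Rightarrow> ereal) \<Rightarrow> 'x \<Rightarrow> ereal" where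
  "max_fun m f x = Max ((\<lambda>k. f k x) ` {1..m})"

definition active_set :: "nat \<Rightarrow> (nat \<Rightarrow> 'x \<Rightarrow> ereal) \<Rightarrow> 'x \<Rightarrow> nat set" where
  "active_set m f x = {k \<in> {1..m}. f k x = max_fun m f x}"

definition feasible_set :: "'x set \<Rightarrow> ('x \<Rightarrow> 'y) \<Rightarrow> 'y set \<Rightarrow> 'x set" where
  "feasible_set A G K = {x \<in> A. G x \<in> K}"

definition globally_optimal :: "('x \<Rightarrow> ereal) \<Rightarrow> 'x set \<Rightarrow> 'x \<Rightarrow> bool" where
  "globally_optimal F S x \<longleftrightarrow> x \<in> S \<and> (\<forall>z\<in>S. F x \<le> F z)"

definition locally_optimal :: "('x::topological_space \<Rightarrow> ereal) \<Rightarrow> 'x set \<Rightarrow> 'x \<Rightarrow> bool" where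
  "locally_optimal F S x \<longleftrightarrow> x \<in> S \<and> (\<exists>U. open U \<and> x \<in> U \<and> (\<forall>z\<in>U \<inter> S. F x \<le> F z))"

definition lagrangian ::
    "('x \<Rightarrow> ereal) \<Rightarrow> ('x \<Rightarrow> 'y::real_normed_vector) \<Rightarrow> 'x \<Rightarrow> ('y \<Rightarrow>\<^sub>L real) \<Rightarrow> ereal" where
  "lagrangian F G x l = F x + ereal (blinfun_apply l (G x))"

definition lagrangian0 ::
    "nat \<Rightarrow> (nat \<Rightarrow> 'x \<Rightarrow> ereal) \<Rightarrow> ('x \<Rightarrow> 'y::real_normed_vector)
       \<Rightarrow> 'x \<Rightarrow> ('y \<Rightarrow>\<^sub>L real) \<Rightarrow> (nat \<Rightarrow> real) \<Rightarrow> ereal" where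
  "lagrangian0 m f G x l \<alpha> =
     (\<Sum>k=1..m. ereal (\<alpha> k) * f k x) + ereal (blinfun_apply l (G x))"

definition aug_lagrangian ::
    "('x \<Rightarrow> ereal) \<Rightarrow> ('x \<Rightarrow> 'y::real_normed_vector) \<Rightarrow> ('y \<Rightarrow> ('y \<Rightarrow>\<^sub>L real) \<Rightarrow> real \<Rightarrow> ereal)
       \<Rightarrow> 'x \<Rightarrow> ('y \<Rightarrow>\<^sub>L real) \<Rightarrow> real \<Rightarrow> ereal" where
  "aug_lagrangian F G \<Phi> x l c = F x + \<Phi> (G x) l c"

definition local_saddle_point ::
    "'x::topological_space set \<Rightarrow> 'l set \<Rightarrow> ('x \<Rightarrow> 'l \<Rightarrow> real \<Rightarrow> ereal) \<Rightarrow> 'x \<Rightarrow> 'l \<Rightarrow> bool" where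
  "local_saddle_point A \<Lambda> \<L> xs ls \<longleftrightarrow>
     xs \<in> A \<and> ls \<in> \<Lambda> \<and>
     (\<exists>c0>0. \<exists>U. open U \<and> xs \<in> U \<and>
        (\<forall>c\<ge>c0. \<L> xs ls c < \<infinity> \<and>
           (SUP l\<in>\<Lambda>. \<L> xs l c) \<le> \<L> xs ls c \<and>
           \<L> xs ls c \<le> (INF x\<in>U \<inter> A. \<L> x ls c)))"


subsection \<open>Optimality conditions\<close>

definition kkt_pair ::
    "('x::real_normed_vector \<Rightarrow> ereal) \<Rightarrow> ('x \<Rightarrow> 'y::real_normed_vector) \<Rightarrow> 'x set \<Rightarrow> 'y set
       \<Rightarrow> 'x \<Rightarrow> ('y \<Rightarrow>\<^sub>L real) \<Rightarrow> bool" where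
  "kkt_pair F G A K x \<mu> \<longleftrightarrow>
     x \<in> A \<and> G x \<in> K \<and> \<mu> \<in> polar_cone K \<and> blinfun_apply \<mu> (G x) = 0 \<and>
     (\<forall>h\<in>contingent_cone A x. \<exists>d\<ge>0. has_directional_deriv (\<lambda>z. lagrangian F G z \<mu>) x h d)"

text \<open>
  A vector of \<open>\<real>\<^sup>m\<close> is a function \<open>nat \<Rightarrow> real\<close> vanishing outside \<open>{1..m}\<close>; this is part of the
  requirement that the multipliers vanish outside the active set.
\<close>

definition objective_multipliers ::
    "nat \<Rightarrow> (nat \<Rightarrow> 'x::real_normed_vector \<Rightarrow> ereal) \<Rightarrow> ('x \<Rightarrow> 'y::real_normed_vector) \<Rightarrow> 'x set
       \<Rightarrow> 'x \<Rightarrow> ('y \<Rightarrow>\<^sub>L real) \<Rightarrow> (nat \<Rightarrow> real) set" where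
  "objective_multipliers m f G A x \<mu> =
     {\<alpha>. (\<forall>k. \<alpha> k \<ge> 0) \<and> (\<forall>k. k \<notin> active_set m f x \<longrightarrow> \<alpha> k = 0) \<and> (\<Sum>k=1..m. \<alpha> k) = 1 \<and>
         (\<forall>h\<in>contingent_cone A x.
            frechet_derivative (\<lambda>z. real_of_ereal (lagrangian0 m f G z \<mu> \<alpha>)) (at x) h \<ge> 0)}"

definition critical_cone ::
    "('x::real_normed_vector \<Rightarrow> 'y::real_normed_vector) \<Rightarrow> 'x set \<Rightarrow> 'y set
       \<Rightarrow> 'x \<Rightarrow> ('y \<Rightarrow>\<^sub>L real) \<Rightarrow> 'x set" where
  "critical_cone G A K x \<mu> =
     {h \<in> contingent_cone A x. frechet_derivative G (at x) h \<in> contingent_cone K (G x) \<and>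
         blinfun_apply \<mu> (frechet_derivative G (at x) h) = 0}"

definition curvature_set ::
    "('x::real_normed_vector \<Rightarrow> 'y::real_normed_vector) \<Rightarrow> 'y set \<Rightarrow> 'x \<Rightarrow> 'x \<Rightarrow> 'y set" where
  "curvature_set G K x h = outer_second_tangent K (G x) (frechet_derivative G (at x) h)"

definition second_order_sufficient ::
    "nat \<Rightarrow> (nat \<Rightarrow> 'x::real_normed_vector \<Rightarrow> ereal) \<Rightarrow> ('x \<Rightarrow> 'y::real_normed_vector) \<Rightarrow> 'x set
       \<Rightarrow> 'y set \<Rightarrow> 'x \<Rightarrow> ('y \<Rightarrow>\<^sub>L real) \<Rightarrow> bool" where
  "second_order_sufficient m f G A K x \<mu> \<longleftrightarrow>
     (\<forall>h\<in>critical_cone G A K x \<mu> - {0}.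
        has_directional_deriv (\<lambda>z. lagrangian (max_fun m f) G z \<mu>) x h 0 \<longrightarrow>
        (SUP \<alpha>\<in>objective_multipliers m f G A x \<mu>.
           ereal (deriv2 (\<lambda>z. real_of_ereal (lagrangian0 m f G z \<mu> \<alpha>)) x h h))
        - support_fun \<mu> (curvature_set G K x h) > 0)"


subsection \<open>Second order expansion of the augmenting term\<close>

definition pos_homogeneous2 :: "('x::real_vector \<Rightarrow> real) \<Rightarrow> bool" where
  "pos_homogeneous2 w \<longleftrightarrow> (\<forall>t>0. \<forall>h. w (t *\<^sub>R h) = t\<^sup>2 * w h)"

text \<open>
  In the last conjunct the upper limit for \<open>h \<rightarrow> h\<^sub>*\<close>, \<open>c \<rightarrow> +\<infinity>\<close> is taken along each way of
  approaching the limit point, that is, along each pair of sequences \<open>hs n \<rightarrow> h\<^sub>*\<close>,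
  \<open>cs n \<rightarrow> +\<infinity>\<close>.  The single unrestricted upper limit
  \<open>Limsup (nhds h\<^sub>* \<times>\<^sub>F at_top) (\<lambda>(h, c). \<omega> c h)\<close> would not do: for \<open>\<omega> c h = c * (h \<bullet> a)\<^sup>2\<close>
  with \<open>a \<noteq> 0\<close> it is \<open>+\<infinity>\<close> at every point, so a condition on the points where it is finite is void.
\<close>

definition admits_second_order_expansion ::
    "('y::real_normed_vector \<Rightarrow> ('y \<Rightarrow>\<^sub>L real) \<Rightarrow> real \<Rightarrow> ereal) \<Rightarrow> ('x::real_normed_vector \<Rightarrow> 'y)
       \<Rightarrow> 'x set \<Rightarrow> 'y set \<Rightarrow> 'x \<Rightarrow> ('y \<Rightarrow>\<^sub>L real) \<Rightarrow> ('y \<Rightarrow>\<^sub>L real) \<Rightarrow> bool" where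
  "admits_second_order_expansion \<Phi> G A K xs ls \<mu>s \<longleftrightarrow>
     (\<exists>\<omega> :: real \<Rightarrow> 'x \<Rightarrow> real.
        (\<forall>c>0. pos_homogeneous2 (\<omega> c) \<and>
           (\<exists>r :: 'x \<Rightarrow> real. ((\<lambda>h. r h / (norm h)\<^sup>2) \<longlongrightarrow> 0) (at 0) \<and>
              (\<forall>\<^sub>F h in nhds 0.
                 \<Phi> (G (xs + h)) ls c - \<Phi> (G xs) ls c =
                 ereal (blinfun_apply \<mu>s (frechet_derivative G (at xs) h)
                        + blinfun_apply \<mu>s (deriv2 G xs h h) / 2 + \<omega> c h / 2 + r h)))) \<and>
        (\<forall>h\<in>critical_cone G A K xs \<mu>s.
           ((\<lambda>c. ereal (\<omega> c h)) \<longlongrightarrow> - support_fun \<mu>s (curvature_set G K xs h)) at_top) \<and>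
        (\<forall>h\<in>contingent_cone A xs. \<forall>hs cs.
           hs \<longlonglongrightarrow> h \<and> filterlim cs at_top sequentially \<and>
           \<bar>limsup (\<lambda>n. ereal (\<omega> (cs n) (hs n)))\<bar> \<noteq> \<infinity> \<longrightarrow>
           h \<in> critical_cone G A K xs \<mu>s \<and>
           limsup (\<lambda>n. ereal (\<omega> (cs n) (hs n))) \<ge> - support_fun \<mu>s (curvature_set G K xs h)))"

end

theory Submission
  imports Defs
begin

text \<open>
  By (A4) the lower bound at the saddle point is needed for one penalty parameter only.  If it fails
  for all parameters, choose violating points \<open>x\<^sub>n \<rightarrow> x\<^sub>*\<close> for parameters \<open>c\<^sub>n \<rightarrow> \<infinity>\<close> whose directions
  converge to a unit vector \<open>u\<close> of \<open>T\<^sub>A(x\<^sub>*)\<close>.  Up to \<open>o(\<parallel>h\<parallel>\<^sup>2)\<close> the augmenting term is the increment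
  of \<open>\<langle>\<mu>\<^sub>*, G\<rangle>\<close> plus \<open>\<omega>\<^sub>c(h)/2\<close>.  Bounding \<open>f\<close> below by \<open>\<Sum>\<alpha>\<^sub>k f\<^sub>k\<close> for a multiplier \<open>\<alpha>\<close> yields
  \<open>limsup \<omega>\<^sub>c\<^sub>n(u\<^sub>n) \<le> -D\<^sup>2L\<^sub>0(x\<^sub>*, \<mu>\<^sub>*, \<alpha>)(u, u)\<close>.  The upper limit is not \<open>-\<infinity>\<close>, because \<open>\<omega>\<^sub>c\<close> increases with
  \<open>c\<close> and \<open>\<omega>\<^sub>1\<close> is bounded on the unit sphere, and it is not \<open>+\<infinity>\<close>, because multipliers exist by a
  separation argument.  Hence \<open>u\<close> is critical and the upper limit is at least \<open>-\<sigma>(\<mu>\<^sub>*, T(u))\<close>, which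
  contradicts the second order sufficient condition at \<open>u\<close>.
\<close>

section \<open>First and second Frechet derivatives, and the second order Taylor formula\<close>

lemma deriv1_eqI:
  assumes "(g has_derivative blinfun_apply D) (at z)"
  shows "deriv1 g z = D"
  unfolding deriv1_def frechet_derivative_at[OF assms, symmetric] by (rule blinfun_apply_inverse)

lemma has_derivative_deriv1:
  assumes "g differentiable (at z)"
  shows "(g has_derivative blinfun_apply (deriv1 g z)) (at z)"
proof -
  have d: "(g has_derivative frechet_derivative g (at z)) (at z)"
    using assms by (simp add: frechet_derivative_works)
  then have "blinfun_apply (deriv1 g z) = frechet_derivative g (at z)"
    unfolding deriv1_def by (intro bounded_linear_Blinfun_apply has_derivative_bounded_linear)
  with d show ?thesis by simp
qed

text \<open>Uniqueness of derivatives forces any local derivative field \<open>D\<close> to agree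
  with \<open>deriv1 g\<close> near \<open>x\<close>, so concrete fields can be used in place of the
  one defined by choice.\<close>

lemma twice_frechet_differentiableI:
  assumes "\<forall>\<^sub>F z in nhds x. (g has_derivative blinfun_apply (D z)) (at z)"
    and D': "(D has_derivative D') (at x)"
  shows "twice_frechet_differentiable g x"
    and "deriv2 g x h k = blinfun_apply (D' h) k"
proof -
  have eq: "\<forall>\<^sub>F z in nhds x. deriv1 g z = D z"
    using assms(1) by eventually_elim (rule deriv1_eqI)
  have "(deriv1 g has_derivative D') (at x)"
  proof (rule has_derivative_transform_eventually[OF D'])
    show "\<forall>\<^sub>F z in at x within UNIV. D z = deriv1 g z"
      using eq by (auto simp: eventually_at_filter elim: eventually_mono)
    show "D x = deriv1 g x"
      using eventually_nhds_x_imp_x[OF eq] by simp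
  qed simp
  then show "twice_frechet_differentiable g x"
    and "deriv2 g x h k = blinfun_apply (D' h) k"
    using assms(1) frechet_derivative_at[of "deriv1 g" D' x]
    by (auto simp: twice_frechet_differentiable_def deriv2_def differentiable_def
        elim: eventually_mono)
qed

lemma twice_frechet_differentiableE:
  assumes "twice_frechet_differentiable g x"
  obtains D' where "\<forall>\<^sub>F z in nhds x. (g has_derivative blinfun_apply (deriv1 g z)) (at z)"
    and "(deriv1 g has_derivative D') (at x)"
    and "\<And>h k. deriv2 g x h k = blinfun_apply (D' h) k"
proof (rule that)
  show "\<forall>\<^sub>F z in nhds x. (g has_derivative blinfun_apply (deriv1 g z)) (at z)"
    using assms unfolding twice_frechet_differentiable_def
    by (auto elim: eventually_mono intro: has_derivative_deriv1)
  show "(deriv1 g has_derivative frechet_derivative (deriv1 g) (at x)) (at x)"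
    using assms by (simp add: twice_frechet_differentiable_def frechet_derivative_works)
  show "deriv2 g x h k = blinfun_apply (frechet_derivative (deriv1 g) (at x) h) k" for h k
    by (simp add: deriv2_def)
qed

lemma twice_frechet_differentiable_imp_has_derivative:
  assumes "twice_frechet_differentiable g x"
  shows "(g has_derivative blinfun_apply (deriv1 g x)) (at x)"
  using assms unfolding twice_frechet_differentiable_def
  by (auto dest!: eventually_nhds_x_imp_x intro: has_derivative_deriv1)

text \<open>Equality near \<open>x\<close> is also equality near every point close to
  \<open>x\<close>, so the derivatives agree on a neighbourhood and can be differentiated once more.
  This carries results from a real-valued formula over to \<open>real_of_ereal\<close> of an
  extended-valued function.\<close>

lemma twice_frechet_differentiable_cong:
  assumes "twice_frechet_differentiable p x" and eq: "\<forall>\<^sub>F z in nhds x. p z = q z"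
  shows "twice_frechet_differentiable q x" and "deriv1 q x = deriv1 p x"
    and "deriv2 q x h k = deriv2 p x h k"
proof -
  obtain D' where D: "\<forall>\<^sub>F z in nhds x. (p has_derivative blinfun_apply (deriv1 p z)) (at z)"
    "(deriv1 p has_derivative D') (at x)" "\<And>h k. deriv2 p x h k = blinfun_apply (D' h) k"
    using assms(1) by (rule twice_frechet_differentiableE) blast
  have q: "\<forall>\<^sub>F z in nhds x. (q has_derivative blinfun_apply (deriv1 p z)) (at z)"
    using D(1) eventually_eventually[THEN iffD2, OF eq]
  proof eventually_elim
    case (elim z)
    then have "\<forall>\<^sub>F y in at z. p y = q y" "p z = q z"
      unfolding eventually_nhds_conv_at by simp_all
    from has_derivative_transform_eventually[OF elim(1) this] show ?case
      by simp
  qed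
  show "twice_frechet_differentiable q x" and "deriv2 q x h k = deriv2 p x h k"
    using twice_frechet_differentiableI[OF q D(2)] D(3) by auto
  show "deriv1 q x = deriv1 p x"
    using deriv1_eqI eventually_nhds_x_imp_x[OF q] by blast
qed

lemma twice_frechet_differentiable_add:
  assumes "twice_frechet_differentiable p x" "twice_frechet_differentiable q x"
  shows "twice_frechet_differentiable (\<lambda>z. p z + q z) x"
proof -
  obtain P where P: "\<forall>\<^sub>F z in nhds x. (p has_derivative blinfun_apply (deriv1 p z)) (at z)"
    "(deriv1 p has_derivative P) (at x)"
    using assms(1) by (rule twice_frechet_differentiableE) blast
  obtain Q where Q: "\<forall>\<^sub>F z in nhds x. (q has_derivative blinfun_apply (deriv1 q z)) (at z)"
    "(deriv1 q has_derivative Q) (at x)"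
    using assms(2) by (rule twice_frechet_differentiableE) blast
  show ?thesis
  proof (rule twice_frechet_differentiableI(1))
    show "\<forall>\<^sub>F z in nhds x. ((\<lambda>z. p z + q z) has_derivative
        blinfun_apply (deriv1 p z + deriv1 q z)) (at z)"
      using P(1) Q(1) by eventually_elim (auto intro!: derivative_eq_intros simp: blinfun.add_left)
    show "((\<lambda>z. deriv1 p z + deriv1 q z) has_derivative (\<lambda>h. P h + Q h)) (at x)"
      using P(2) Q(2) by (rule has_derivative_add)
  qed
qed

lemma twice_frechet_differentiable_compose_blinfun:
  assumes "twice_frechet_differentiable p x"
  shows "twice_frechet_differentiable (\<lambda>z. blinfun_apply l (p z)) x"
    and "deriv1 (\<lambda>z. blinfun_apply l (p z)) x = l o\<^sub>L deriv1 p x"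
    and "deriv2 (\<lambda>z. blinfun_apply l (p z)) x h k = blinfun_apply l (deriv2 p x h k)"
proof -
  obtain P where P: "\<forall>\<^sub>F z in nhds x. (p has_derivative blinfun_apply (deriv1 p z)) (at z)"
    "(deriv1 p has_derivative P) (at x)" "\<And>h k. deriv2 p x h k = blinfun_apply (P h) k"
    using assms by (rule twice_frechet_differentiableE) blast
  have 1: "\<forall>\<^sub>F z in nhds x. ((\<lambda>z. blinfun_apply l (p z)) has_derivative
      blinfun_apply (l o\<^sub>L deriv1 p z)) (at z)"
    using P(1)
    by eventually_elim (auto intro!: derivative_eq_intros)
  have 2: "((\<lambda>z. l o\<^sub>L deriv1 p z) has_derivative (\<lambda>h. l o\<^sub>L P h)) (at x)"
    using bounded_linear.has_derivative[OF bounded_bilinear.bounded_linear_right[OF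
          bounded_bilinear_blinfun_compose] P(2)] .
  show "twice_frechet_differentiable (\<lambda>z. blinfun_apply l (p z)) x"
    and "deriv2 (\<lambda>z. blinfun_apply l (p z)) x h k = blinfun_apply l (deriv2 p x h k)"
    using twice_frechet_differentiableI[OF 1 2] P(3) by auto
  show "deriv1 (\<lambda>z. blinfun_apply l (p z)) x = l o\<^sub>L deriv1 p x"
    using deriv1_eqI eventually_nhds_x_imp_x[OF 1] by blast
qed

lemma twice_frechet_differentiable_cmult:
  assumes "twice_frechet_differentiable p x"
  shows "twice_frechet_differentiable (\<lambda>z. (c::real) * p z) x"
  using twice_frechet_differentiable_compose_blinfun(1)[OF assms, of "blinfun_scaleR_right c"]
  by simp

lemma twice_frechet_differentiable_const: "twice_frechet_differentiable (\<lambda>z::'a::real_normed_vector. c) x"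
  by (rule twice_frechet_differentiableI(1)[where D = "\<lambda>z. 0" and D' = "\<lambda>h. 0"])
    (auto simp: zero_blinfun.rep_eq)

lemma twice_frechet_differentiable_sum:
  assumes "\<And>i. i \<in> I \<Longrightarrow> twice_frechet_differentiable (p i) x"
  shows "twice_frechet_differentiable (\<lambda>z. \<Sum>i\<in>I. p i z) x"
  using assms
  by (induction I rule: infinite_finite_induct)
    (auto intro: twice_frechet_differentiable_add twice_frechet_differentiable_const)

text \<open>
  Only the derivative of \<^term>\<open>deriv1 g\<close> at \<^term>\<open>x\<close> is available, so the mean value theorem is
  applied to \<^term>\<open>g\<close> minus its quadratic model along each ray; symmetry of the second derivative
  is not involved.
\<close>

lemma second_order_taylor:
  fixes g :: "'a::real_normed_vector \<Rightarrow> real"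
  assumes "twice_frechet_differentiable g x"
  shows "((\<lambda>h. (g (x + h) - g x - blinfun_apply (deriv1 g x) h - deriv2 g x h h / 2)
            / (norm h)\<^sup>2) \<longlongrightarrow> 0) (at 0)"
proof -
  obtain D' where D: "\<forall>\<^sub>F z in nhds x. (g has_derivative blinfun_apply (deriv1 g z)) (at z)"
    "(deriv1 g has_derivative D') (at x)" "\<And>h k. deriv2 g x h k = blinfun_apply (D' h) k"
    using assms by (rule twice_frechet_differentiableE) blast
  interpret D': bounded_linear D' using D(2) by (rule has_derivative_bounded_linear)
  obtain d0 where d0: "d0 > 0"
    "\<And>z. dist z x < d0 \<Longrightarrow> (g has_derivative blinfun_apply (deriv1 g z)) (at z)"
    using D(1) by (auto simp: eventually_nhds_metric)
  show ?thesis
  proof (rule tendstoI)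
    fix e :: real assume "e > 0"
    then have "e / 2 > 0" by simp
    then obtain d1 where d1: "d1 > 0"
      "\<And>z. norm (z - x) < d1 \<Longrightarrow> norm (deriv1 g z - deriv1 g x - D' (z - x)) \<le> e / 2 * norm (z - x)"
      using D(2)[unfolded has_derivative_at_alt] by blast
    have "norm (g (x + h) - g x - blinfun_apply (deriv1 g x) h - deriv2 g x h h / 2)
            \<le> e / 2 * (norm h)\<^sup>2" if h: "norm h < min d0 d1" for h
    proof -
      define \<psi> where "\<psi> s = g (x + s *\<^sub>R h) - s * blinfun_apply (deriv1 g x) h
          - s\<^sup>2 / 2 * blinfun_apply (D' h) h" for s
      \<comment> \<open>This is the derivative of \<open>\<psi>\<close>: the first order remainder
        of \<open>deriv1 g\<close> at \<open>x\<close>, applied to \<open>h\<close>.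
        Differentiability of \<open>deriv1 g\<close> at \<open>x\<close> makes it small.\<close>
      define \<psi>' where "\<psi>' s = blinfun_apply (deriv1 g (x + s *\<^sub>R h) - deriv1 g x - D' (s *\<^sub>R h)) h" for s
      have small: "norm (s *\<^sub>R h) < d0 \<and> norm (s *\<^sub>R h) < d1 \<and> norm (s *\<^sub>R h) \<le> norm h"
        if "0 \<le> s" "s \<le> 1" for s :: real
        using that h mult_left_le_one_le[of "norm h" s] by auto
      have der: "(\<psi> has_real_derivative \<psi>' s) (at s)" if "0 \<le> s" "s \<le> 1" for s
      proof -
        have g: "(g has_derivative blinfun_apply (deriv1 g (x + s *\<^sub>R h))) (at (x + s *\<^sub>R h))"
          using d0(2) small[OF that] by (simp add: dist_norm)
        have "((\<lambda>s. x + s *\<^sub>R h) has_derivative (\<lambda>t. t *\<^sub>R h)) (at s)"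
          by (auto intro!: derivative_eq_intros)
        from diff_chain_at[OF this g]
        have "((\<lambda>s. g (x + s *\<^sub>R h)) has_real_derivative blinfun_apply (deriv1 g (x + s *\<^sub>R h)) h) (at s)"
          by (simp add: has_field_derivative_def o_def blinfun.scaleR_right mult_commute_abs)
        then show ?thesis unfolding \<psi>_def \<psi>'_def
          by (auto intro!: derivative_eq_intros
              simp: blinfun.diff_left D'.scaleR blinfun.scaleR_left)
      qed
      \<comment> \<open>The increment of \<open>\<psi>\<close> over the unit interval is exactly the
        Taylor remainder, since \<open>\<psi> 0 = g x\<close>.\<close>
      obtain s where s: "0 < s" "s < 1" "\<psi> 1 - \<psi> 0 = (1 - 0) * \<psi>' s"
        using MVT2[of 0 1 \<psi> \<psi>'] der by auto
      have "norm (\<psi>' s) \<le> norm (deriv1 g (x + s *\<^sub>R h) - deriv1 g x - D' (s *\<^sub>R h)) * norm h"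
        unfolding \<psi>'_def by (rule norm_blinfun)
      also have "\<dots> \<le> (e / 2 * norm (s *\<^sub>R h)) * norm h"
        using d1(2)[of "x + s *\<^sub>R h"] small[of s] s by (intro mult_right_mono) auto
      also have "\<dots> \<le> (e / 2 * norm h) * norm h"
        using small[of s] s \<open>e > 0\<close> by (intro mult_right_mono mult_left_mono) auto
      finally have "norm (\<psi>' s) \<le> e / 2 * (norm h)\<^sup>2" by (simp add: power2_eq_square)
      moreover have "g (x + h) - g x - blinfun_apply (deriv1 g x) h - deriv2 g x h h / 2 = \<psi>' s"
        using s(3) by (simp add: \<psi>_def D(3))
      ultimately show ?thesis by simp
    qed
    then have "dist ((g (x + h) - g x - blinfun_apply (deriv1 g x) h - deriv2 g x h h / 2)
            / (norm h)\<^sup>2) 0 < e" if "h \<noteq> 0" "dist h 0 < min d0 d1" for h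
    proof -
      have "norm (g (x + h) - g x - blinfun_apply (deriv1 g x) h - deriv2 g x h h / 2)
          < e * (norm h)\<^sup>2"
        using that \<open>e > 0\<close> by (intro order.strict_trans1[OF \<open>_ \<Longrightarrow> _ \<le> e / 2 * (norm h)\<^sup>2\<close>]) auto
      then show ?thesis using that by (simp add: field_simps)
    qed
    then show "\<forall>\<^sub>F h in at 0. dist ((g (x + h) - g x - blinfun_apply (deriv1 g x) h
        - deriv2 g x h h / 2) / (norm h)\<^sup>2) 0 < e"
      using d0(1) d1(1) unfolding eventually_at by (intro exI[of _ "min d0 d1"]) auto
  qed
qed


section \<open>Convex multipliers by separation\<close>

text \<open>The points \<open>v k\<close> may coincide, so the weight of a point of the image is
  given to one chosen index that maps to it, and all other indices receive 0.\<close>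

lemma convex_hull_finite_image_weights:
  assumes I: "finite I" and x: "x \<in> convex hull (v ` I)"
  obtains \<alpha> where "\<And>k. \<alpha> k \<ge> 0" and "\<And>k. k \<notin> I \<Longrightarrow> \<alpha> k = (0::real)"
    and "sum \<alpha> I = 1" and "(\<Sum>k\<in>I. \<alpha> k *\<^sub>R v k) = x"
proof -
  obtain u where u: "\<And>y. y \<in> v ` I \<Longrightarrow> 0 \<le> u y" "sum u (v ` I) = 1" "(\<Sum>y\<in>v ` I. u y *\<^sub>R y) = x"
    using x I by (auto simp: convex_hull_finite)
  define J where "J = inv_into I v ` v ` I"
  have J: "J \<subseteq> I" unfolding J_def by (auto intro: inv_into_into)
  define \<alpha> where "\<alpha> k = (if k \<in> J then u (v k) else 0)" for k
  have reindex: "(\<Sum>k\<in>J. F (v k)) = (\<Sum>y\<in>v ` I. F y)" for F :: "'b \<Rightarrow> 'c::comm_monoid_add"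
    unfolding J_def by (subst sum.reindex) (auto simp: inj_on_inv_into f_inv_into_f intro!: sum.cong)
  show thesis
  proof (rule that)
    show "\<alpha> k \<ge> 0" for k using u(1) J by (auto simp: \<alpha>_def)
    show "\<alpha> k = 0" if "k \<notin> I" for k using that J by (auto simp: \<alpha>_def)
    have "sum \<alpha> I = sum \<alpha> J"
      by (rule sum.mono_neutral_right) (use I J in \<open>auto simp: \<alpha>_def\<close>)
    then show "sum \<alpha> I = 1" using u(2) reindex[of u] by (simp add: \<alpha>_def)
    have "(\<Sum>k\<in>I. \<alpha> k *\<^sub>R v k) = (\<Sum>k\<in>J. \<alpha> k *\<^sub>R v k)"
      by (rule sum.mono_neutral_right) (use I J in \<open>auto simp: \<alpha>_def\<close>)
    then show "(\<Sum>k\<in>I. \<alpha> k *\<^sub>R v k) = x"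
      using u(3) reindex[of "\<lambda>y. u y *\<^sub>R y"] by (simp add: \<alpha>_def)
  qed
qed

text \<open>A negative value of the functional could be scaled, inside the cone, to equal
  \<open>b\<close>, against the strict bound.\<close>

lemma cone_bounded_below_imp_nonneg:
  fixes a :: "'a::real_inner"
  assumes "conic N" and bd: "\<And>w. w \<in> N \<Longrightarrow> b < a \<bullet> w" and w: "w \<in> N"
  shows "a \<bullet> w \<ge> 0"
proof (rule ccontr)
  assume neg: "\<not> a \<bullet> w \<ge> 0"
  have "(0::real) *\<^sub>R w \<in> N" using assms(1) w by (meson conicD order_refl)
  then have "b < 0" using bd[of 0] by simp
  then have "(b / (a \<bullet> w)) *\<^sub>R w \<in> N"
    using neg assms(1) w by (intro conicD) (auto simp: divide_nonpos_neg)
  from bd[OF this] neg show False by simp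
qed

text \<open>
  If no multiplier exists, the convex hull of the \<^term>\<open>v k\<close> is strictly separated from the dual
  cone of \<^term>\<open>B\<close>; by the bipolar theorem the separating direction lies in the closure of the cone
  generated by \<^term>\<open>B\<close>, where all \<^term>\<open>v k\<close> are negative.
\<close>

lemma exists_convex_multipliers:
  fixes v :: "'i \<Rightarrow> 'a::euclidean_space"
  assumes I: "finite I" "I \<noteq> {}" and B: "convex B" "B \<noteq> {}"
    and nonneg: "\<And>b. b \<in> B \<Longrightarrow> \<exists>k\<in>I. v k \<bullet> b \<ge> 0"
  obtains \<alpha> where "\<And>k. \<alpha> k \<ge> 0" and "\<And>k. k \<notin> I \<Longrightarrow> \<alpha> k = (0::real)" and "sum \<alpha> I = 1"
    and "\<And>b. b \<in> B \<Longrightarrow> (\<Sum>k\<in>I. \<alpha> k * (v k \<bullet> b)) \<ge> 0"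
proof -
  define N where "N = {w. \<forall>b\<in>B. w \<bullet> b \<ge> 0}"
  have N: "convex N" "closed N" "conic N"
  proof -
    have "N = (\<Inter>b\<in>B. {w. b \<bullet> w \<ge> 0})" by (auto simp: N_def inner_commute)
    then show "convex N" "closed N"
      by (auto intro!: convex_INT closed_INT simp: convex_halfspace_ge closed_halfspace_ge)
    show "conic N" by (auto simp: conic_def N_def)
  qed
  have "convex hull (v ` I) \<inter> N \<noteq> {}"
  proof
    assume "convex hull (v ` I) \<inter> N = {}"
    then obtain a \<beta> where sep: "\<And>x. x \<in> convex hull (v ` I) \<Longrightarrow> a \<bullet> x < \<beta>"
      "\<And>w. w \<in> N \<Longrightarrow> \<beta> < a \<bullet> w"
      using separating_hyperplane_compact_closed[of "convex hull (v ` I)" N] N I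
      by (metis compact_convex_hull convex_convex_hull convex_hull_eq_empty finite_imageI
          finite_imp_compact image_is_empty)
    have "\<beta> < 0" using sep(2)[of 0] by (simp add: N_def)
    have aN: "a \<bullet> w \<ge> 0" if "w \<in> N" for w
      using cone_bounded_below_imp_nonneg[OF N(3) sep(2) that] .
    \<comment> \<open>Bipolar argument: a hyperplane that separates \<open>a\<close> from the closed
      cone has its normal \<open>w\<close> in \<open>N\<close>, yet \<open>w\<close> is negative at
      \<open>a\<close>, against \<open>aN\<close>.\<close>
    have a: "a \<in> closure (cone hull B)"
    proof (rule ccontr)
      assume "a \<notin> closure (cone hull B)"
      then obtain w b where w: "w \<bullet> a < b" "\<And>p. p \<in> closure (cone hull B) \<Longrightarrow> b < w \<bullet> p"
        using separating_hyperplane_closed_point[of "closure (cone hull B)" a]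
          convex_closure convex_cone_hull[OF B(1)] by auto
      then have w': "\<And>p. p \<in> cone hull B \<Longrightarrow> b < w \<bullet> p"
        using closure_subset by blast
      have "b < 0" using w'[of 0] B(2) cone_hull_contains_0[of B] by simp
      have "conic (cone hull B)"
        using cone_cone_hull[of B] by (simp add: cone_def conic_def)
      from cone_bounded_below_imp_nonneg[OF this w'] have "w \<in> N"
        unfolding N_def using hull_subset[of B cone] by blast
      then show False using aN w(1) \<open>b < 0\<close> by (force simp: inner_commute)
    qed
    \<comment> \<open>Openness of this set replaces the limit point \<open>a\<close> by a point of
      the cone itself, a multiple of some element of \<open>B\<close>.\<close>
    define O' where "O' = (\<Inter>k\<in>I. {p. v k \<bullet> p < 0})"
    have "open O'" unfolding O'_def using I(1) by (intro open_INT) (auto simp: open_halfspace_lt)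
    moreover have "a \<in> O'"
      using sep(1)[OF hull_inc] \<open>\<beta> < 0\<close> by (fastforce simp: O'_def inner_commute)
    ultimately obtain p where p: "p \<in> O'" "p \<in> cone hull B"
      using a by (meson closure_iff_nhds_not_empty open_contains_ball disjoint_iff order_refl)
    then obtain c b where b: "p = c *\<^sub>R b" "c \<ge> 0" "b \<in> B"
      by (auto simp: cone_hull_expl)
    obtain k where "k \<in> I" "v k \<bullet> b \<ge> 0" using nonneg b(3) by blast
    then show False using p(1) b by (auto simp: O'_def mult_less_0_iff)
  qed
  then obtain x where x: "x \<in> convex hull (v ` I)" "x \<in> N" by blast
  from I(1) x(1) obtain \<alpha> where \<alpha>: "\<And>k. \<alpha> k \<ge> 0" "\<And>k. k \<notin> I \<Longrightarrow> \<alpha> k = 0" "sum \<alpha> I = 1"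
    "(\<Sum>k\<in>I. \<alpha> k *\<^sub>R v k) = x"
    by (rule convex_hull_finite_image_weights) blast
  show thesis
  proof (rule that[OF \<alpha>(1-3)])
    fix b assume "b \<in> B"
    then have "0 \<le> x \<bullet> b" using x(2) by (simp add: N_def)
    then show "(\<Sum>k\<in>I. \<alpha> k * (v k \<bullet> b)) \<ge> 0"
      by (simp add: \<alpha>(4)[symmetric] inner_sum_left)
  qed
qed

section \<open>Directional derivatives of a finite maximum\<close>

lemma has_derivative_imp_directional_limit:
  fixes q :: "'a::real_normed_vector \<Rightarrow> real"
  assumes "(q has_derivative D) (at x)"
  shows "((\<lambda>t. (q (x + t *\<^sub>R h) - q x) / t) \<longlongrightarrow> D h) (at 0)"
proof -
  interpret D: bounded_linear D using assms by (rule has_derivative_bounded_linear)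
  have "((\<lambda>t. x + t *\<^sub>R h) has_derivative (\<lambda>t. t *\<^sub>R h)) (at 0)"
    by (auto intro!: derivative_eq_intros)
  moreover have "(q has_derivative D) (at (x + 0 *\<^sub>R h))" using assms by simp
  ultimately have "((\<lambda>t. q (x + t *\<^sub>R h)) has_derivative (\<lambda>t. D (t *\<^sub>R h))) (at 0)"
    using diff_chain_at[of "\<lambda>t. x + t *\<^sub>R h" _ 0 q D] by (simp add: o_def)
  then have "((\<lambda>t. q (x + t *\<^sub>R h)) has_real_derivative D h) (at 0)"
    by (simp add: has_field_derivative_def D.scaleR mult_commute_abs)
  then show ?thesis by (simp add: DERIV_def)
qed

text \<open>By the pigeonhole principle one index attains the maximum infinitely often along step
  lengths tending to 0. On that subsequence the difference quotients of the maximum are those of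
  \<open>q k\<close>, and uniqueness of limits identifies \<open>d\<close>.\<close>

lemma directional_deriv_of_Max:
  fixes q :: "'i \<Rightarrow> 'a::real_normed_vector \<Rightarrow> real"
  assumes I: "finite I" "I \<noteq> {}"
    and q: "\<And>k. k \<in> I \<Longrightarrow> (q k has_derivative D k) (at x)"
    and p: "\<forall>\<^sub>F z in nhds x. p z = ereal (Max ((\<lambda>k. q k z) ` I))"
    and d: "has_directional_deriv p x h d"
  obtains k where "k \<in> I" and "q k x = Max ((\<lambda>k. q k x) ` I)" and "d = ereal (D k h)"
proof -
  define t where "t n = inverse (real (Suc n))" for n
  have t: "t n > 0" for n by (simp add: t_def)
  have t0: "t \<longlonglongrightarrow> 0" unfolding t_def by (rule LIMSEQ_inverse_real_of_nat)
  have "\<forall>n. \<exists>k\<in>I. q k (x + t n *\<^sub>R h) = Max ((\<lambda>k. q k (x + t n *\<^sub>R h)) ` I)"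
  proof
    fix n
    have "Max ((\<lambda>k. q k (x + t n *\<^sub>R h)) ` I) \<in> (\<lambda>k. q k (x + t n *\<^sub>R h)) ` I"
      using I by (intro Max_in) auto
    then show "\<exists>k\<in>I. q k (x + t n *\<^sub>R h) = Max ((\<lambda>k. q k (x + t n *\<^sub>R h)) ` I)"
      by (rule imageE) auto
  qed
  then have "\<exists>k\<in>I. \<not> finite {n\<in>UNIV. q k (x + t n *\<^sub>R h) = Max ((\<lambda>k. q k (x + t n *\<^sub>R h)) ` I)}"
    using I(1) by (intro pigeonhole_infinite_rel) auto
  then obtain k where k: "k \<in> I"
    "infinite {n. q k (x + t n *\<^sub>R h) = Max ((\<lambda>k. q k (x + t n *\<^sub>R h)) ` I)}" by auto
  obtain s :: "nat \<Rightarrow> nat" where s: "strict_mono s"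
    "\<And>n. q k (x + t (s n) *\<^sub>R h) = Max ((\<lambda>k. q k (x + t (s n) *\<^sub>R h)) ` I)"
    using infinite_enumerate[OF k(2)] by auto
  have ts: "(\<lambda>n. t (s n)) \<longlonglongrightarrow> 0" using LIMSEQ_subseq_LIMSEQ[OF t0 s(1)] by (simp add: o_def)
  have ts0: "filterlim (\<lambda>n. t (s n)) (at 0) sequentially"
    using ts t by (auto simp: filterlim_at eventually_sequentially less_imp_neq[THEN not_sym])
  have tsr: "filterlim (\<lambda>n. t (s n)) (at_right 0) sequentially"
    using ts t by (auto simp: filterlim_at eventually_sequentially less_imp_neq[THEN not_sym])
  have xs: "(\<lambda>n. x + t (s n) *\<^sub>R h) \<longlonglongrightarrow> x" using ts by (auto intro!: tendsto_eq_intros)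
  \<comment> \<open>Continuity passes the inequalities between \<open>q k\<close> and the other
    functions to the limit \<open>x\<close>.\<close>
  have act: "q k x = Max ((\<lambda>k. q k x) ` I)"
  proof (rule sym, rule Max_eqI)
    fix y assume "y \<in> (\<lambda>k. q k x) ` I"
    then obtain j where j: "j \<in> I" "y = q j x" by auto
    have lim: "(\<lambda>n. q i (x + t (s n) *\<^sub>R h)) \<longlonglongrightarrow> q i x" if "i \<in> I" for i
      by (rule isCont_tendsto_compose[OF has_derivative_continuous[OF q[OF that]] xs])
    show "y \<le> q k x" unfolding j(2)
      by (rule LIMSEQ_le[OF lim[OF j(1)] lim[OF k(1)]]) (use s(2) I j in auto)
  qed (use I k in auto)
  have "(\<lambda>n. (q k (x + t (s n) *\<^sub>R h) - q k x) / t (s n)) \<longlonglongrightarrow> D k h"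
    using filterlim_compose[OF has_derivative_imp_directional_limit[OF q[OF k(1)]] ts0] .
  then have 1: "(\<lambda>n. ereal ((q k (x + t (s n) *\<^sub>R h) - q k x) / t (s n))) \<longlonglongrightarrow> ereal (D k h)"
    by simp
  have 2: "(\<lambda>n. (p (x + t (s n) *\<^sub>R h) - p x) / ereal (t (s n))) \<longlonglongrightarrow> d"
    using filterlim_compose[OF d[unfolded has_directional_deriv_def] tsr] .
  have "\<forall>\<^sub>F n in sequentially. (p (x + t (s n) *\<^sub>R h) - p x) / ereal (t (s n))
      = ereal ((q k (x + t (s n) *\<^sub>R h) - q k x) / t (s n))"
    using xs[unfolded filterlim_def le_filter_def, rule_format, OF p, unfolded eventually_filtermap]
  proof eventually_elim
    case (elim n)
    have "t (s n) \<noteq> 0" using t[of "s n"] by simp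
    then show ?case
      using elim eventually_nhds_x_imp_x[OF p] by (simp add: s(2)[symmetric] act[symmetric])
  qed
  from tendsto_cong[OF this] 1 2 have "d = ereal (D k h)"
    using LIMSEQ_unique by blast
  with k(1) act show thesis by (rule that)
qed


section \<open>Limits along sequences that violate the lower bound\<close>

lemma has_derivative_sequential_quotient:
  fixes q :: "'a::real_normed_vector \<Rightarrow> real"
  assumes q: "(q has_derivative D) (at x)"
    and t: "\<And>n. t n > 0" "t \<longlonglongrightarrow> 0" and u: "us \<longlonglongrightarrow> u"
  shows "(\<lambda>n. (q (x + t n *\<^sub>R us n) - q x) / t n) \<longlonglongrightarrow> D u"
proof -
  interpret D: bounded_linear D using q by (rule has_derivative_bounded_linear)
  \<comment> \<open>The normalised remainder, set to 0 at \<open>x\<close>, is continuous there. The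
    value 0 also keeps the quotient identity below valid when \<open>us n = 0\<close>.\<close>
  define e where "e y = (if y = x then 0 else (q y - q x - D (y - x)) / norm (y - x))" for y
  have "((\<lambda>y. (q y - q x - D (y - x)) / norm (y - x)) \<longlongrightarrow> 0) (at x)"
    using q by (simp add: has_derivative_at_within divide_inverse mult.commute)
  then have "(e \<longlongrightarrow> 0) (at x)"
    by (rule Lim_transform_eventually) (auto simp: e_def eventually_at intro!: exI[of _ 1])
  then have "isCont e x" by (simp add: isCont_def e_def)
  moreover have "(\<lambda>n. x + t n *\<^sub>R us n) \<longlonglongrightarrow> x"
    using t(2) u by (auto intro!: tendsto_eq_intros)
  ultimately have "(\<lambda>n. e (x + t n *\<^sub>R us n)) \<longlonglongrightarrow> 0"
    by (auto dest: isCont_tendsto_compose simp: e_def)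
  then have "(\<lambda>n. D (us n) + e (x + t n *\<^sub>R us n) * norm (us n)) \<longlonglongrightarrow> D u + 0 * norm u"
    by (intro tendsto_intros D.tendsto u)
  moreover have "(q (x + t n *\<^sub>R us n) - q x) / t n = D (us n) + e (x + t n *\<^sub>R us n) * norm (us n)" for n
    using t(1)[of n] by (auto simp: e_def D.scaleR field_simps D.zero)
  ultimately show ?thesis by simp
qed

text \<open>
  The expansion is not uniform in \<open>c\<close>, hence the violating increment for the parameter \<open>c\<close> is taken
  where the remainder is below the squared norm divided by \<open>c\<close>.
\<close>

lemma violating_directions:
  fixes x :: "'a::euclidean_space" and q :: "'i \<Rightarrow> 'a \<Rightarrow> real" and I :: "'i set"
    and \<omega> \<rho> :: "real \<Rightarrow> 'a \<Rightarrow> real"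
  defines "Q \<equiv> \<lambda>z. Max ((\<lambda>k. q k z) ` I)"
  assumes I: "finite I" "I \<noteq> {}"
    and A: "convex A" "x \<in> A"
    and q: "\<And>k. k \<in> I \<Longrightarrow> twice_frechet_differentiable (q k) x"
    and hom: "\<And>c. c > 0 \<Longrightarrow> pos_homogeneous2 (\<omega> c)"
    and below: "\<And>c u. c \<ge> 1 \<Longrightarrow> norm u = 1 \<Longrightarrow> B \<le> \<omega> c u"
    and \<rho>: "\<And>c. c > 0 \<Longrightarrow> ((\<lambda>h. \<rho> c h / (norm h)\<^sup>2) \<longlongrightarrow> 0) (at 0)"
    and violated: "\<And>c \<delta>. c \<ge> 1 \<Longrightarrow> \<delta> > 0 \<Longrightarrow>
      \<exists>h. h \<noteq> 0 \<and> x + h \<in> A \<and> norm h < \<delta> \<and> Q (x + h) + \<omega> c h / 2 + \<rho> c h < Q x"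
  obtains u hs cs where "u \<in> contingent_cone A x" "norm u = 1" "hs \<longlonglongrightarrow> u"
    "filterlim cs at_top sequentially"
    "ereal B \<le> limsup (\<lambda>n. ereal (\<omega> (cs n) (hs n)))"
    "\<And>\<alpha>. (\<And>k. \<alpha> k \<ge> 0) \<Longrightarrow> (\<And>k. q k x \<noteq> Q x \<Longrightarrow> \<alpha> k = 0) \<Longrightarrow> sum \<alpha> I = 1 \<Longrightarrow>
       (\<And>h. x + h \<in> A \<Longrightarrow> 0 \<le> blinfun_apply (deriv1 (\<lambda>z. \<Sum>k\<in>I. \<alpha> k * q k z) x) h) \<Longrightarrow>
       limsup (\<lambda>n. ereal (\<omega> (cs n) (hs n))) \<le> ereal (- deriv2 (\<lambda>z. \<Sum>k\<in>I. \<alpha> k * q k z) x u u)"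
    "\<And>k. k \<in> I \<Longrightarrow> q k x = Q x \<Longrightarrow> blinfun_apply (deriv1 (q k) x) u \<le> 0"
proof -
  \<comment> \<open>The parameter \<open>c n\<close> also sets the scale: the violating increment is
    taken shorter than \<open>1 / c n\<close> and with remainder below its squared norm divided by
    \<open>c n\<close>.\<close>
  define c where "c n = real (Suc n)" for n
  have c: "c n \<ge> 1" for n by (simp add: c_def)
  have "\<exists>h. h \<noteq> 0 \<and> x + h \<in> A \<and> norm h < 1 / c n \<and>
      Q (x + h) - Q x + \<omega> (c n) h / 2 < (norm h)\<^sup>2 / c n" for n
  proof -
    have "1 / c n > 0" using c[of n] by simp
    then have "\<forall>\<^sub>F h in at 0. dist (\<rho> (c n) h / (norm h)\<^sup>2) 0 < 1 / c n"
      using \<rho>[of "c n"] c[of n] by (intro tendstoD) auto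
    then obtain d where d: "d > 0" "\<And>h. h \<noteq> 0 \<Longrightarrow> norm h < d \<Longrightarrow> \<bar>\<rho> (c n) h\<bar> / (norm h)\<^sup>2 < 1 / c n"
      by (auto simp: eventually_at)
    obtain h where h: "h \<noteq> 0" "x + h \<in> A" "norm h < min d (1 / c n)"
      "Q (x + h) + \<omega> (c n) h / 2 + \<rho> (c n) h < Q x"
      using violated[OF c, of "min d (1 / c n)"] d(1) \<open>1 / c n > 0\<close> by auto
    have "\<bar>\<rho> (c n) h\<bar> < (norm h)\<^sup>2 / c n"
      using d(2)[of h] h(1,3) c[of n] by (simp add: field_simps)
    then show ?thesis using h by (intro exI[of _ h]) auto
  qed
  then obtain h where h: "\<And>n. h n \<noteq> 0" "\<And>n. x + h n \<in> A" "\<And>n. norm (h n) < 1 / c n"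
    "\<And>n. Q (x + h n) - Q x + \<omega> (c n) (h n) / 2 < (norm (h n))\<^sup>2 / c n"
    by metis
  define v where "v n = h n /\<^sub>R norm (h n)" for n
  have "norm (v n) = 1" for n using h(1) by (simp add: v_def)
  \<comment> \<open>Compactness of the unit sphere, the place where finite dimension enters this
    argument.\<close>
  then obtain u s where us: "norm u = 1" "strict_mono (s :: nat \<Rightarrow> nat)" "(v \<circ> s) \<longlonglongrightarrow> u"
    using compact_sphere[of "0::'a" 1] unfolding compact_def by fastforce
  define t where "t n = norm (h (s n))" for n
  define w where "w n = v (s n)" for n
  define cs where "cs n = c (s n)" for n
  have t: "t n > 0" for n using h(1) by (simp add: t_def)
  have tw: "t n *\<^sub>R w n = h (s n)" for n using h(1) by (simp add: t_def w_def v_def)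
  have nw: "norm (w n) = 1" for n using h(1) by (simp add: w_def v_def)
  have w: "w \<longlonglongrightarrow> u" using us(3) by (simp add: o_def w_def[abs_def])
  have c_top: "filterlim c at_top sequentially"
    unfolding c_def
    by (rule filterlim_compose[OF filterlim_real_sequentially filterlim_Suc])
  have cs: "filterlim cs at_top sequentially"
    unfolding cs_def by (rule filterlim_compose[OF c_top filterlim_subseq[OF us(2)]])
  have cs1: "cs n \<ge> 1" for n using c by (simp add: cs_def)
  have inv_cs: "(\<lambda>n. 1 / cs n) \<longlonglongrightarrow> 0"
    using tendsto_inverse_0_at_top[OF cs] by (simp add: divide_inverse)
  have t0: "t \<longlonglongrightarrow> 0"
  proof (rule tendsto_sandwich[OF _ _ tendsto_const inv_cs])
    show "\<forall>\<^sub>F n in sequentially. 0 \<le> t n" using t by (simp add: less_imp_le)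
    show "\<forall>\<^sub>F n in sequentially. t n \<le> 1 / cs n"
      using h(3) by (simp add: t_def cs_def less_imp_le)
  qed
  \<comment> \<open>Homogeneity of degree 2 turns division by \<open>(t n)\<^sup>2\<close> into
    evaluation of \<open>\<omega>\<close> at the unit direction.\<close>
  have key: "(Q (x + t n *\<^sub>R w n) - Q x) / (t n)\<^sup>2 + \<omega> (cs n) (w n) / 2 < 1 / cs n" for n
  proof -
    have "\<omega> (cs n) (t n *\<^sub>R w n) = (t n)\<^sup>2 * \<omega> (cs n) (w n)"
      using hom[of "cs n"] cs1[of n] t[of n] by (auto simp: pos_homogeneous2_def)
    then have "Q (x + t n *\<^sub>R w n) - Q x + (t n)\<^sup>2 * \<omega> (cs n) (w n) / 2 < (t n)\<^sup>2 * (1 / cs n)"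
      using h(4)[of "s n", folded t_def cs_def] by (simp add: tw)
    then have "(Q (x + t n *\<^sub>R w n) - Q x + (t n)\<^sup>2 * \<omega> (cs n) (w n) / 2) / (t n)\<^sup>2 < 1 / cs n"
      using t[of n] by (simp add: pos_divide_less_eq mult.commute)
    then show ?thesis using t[of n] by (simp add: add_divide_distrib)
  qed
  have q_le: "q k z \<le> Q z" if "k \<in> I" for k z
    using that I by (auto simp: Q_def)
  show thesis
  proof (rule that[of u w cs])
    show "u \<in> contingent_cone A x"
      unfolding contingent_cone_def using t t0 w h(2) by (auto simp: tw intro!: exI[of _ t] exI[of _ w])
    show "ereal B \<le> limsup (\<lambda>n. ereal (\<omega> (cs n) (w n)))"
      by (rule le_Limsup) (use below cs1 nw in auto)
    \<comment> \<open>Dividing by \<open>t n\<close> only once leaves a factor \<open>t n\<close> on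
      the right of \<open>key\<close>; the uniform bound \<open>B\<close> on \<open>\<omega>\<close>
      then sends the right side to 0.\<close>
    show "blinfun_apply (deriv1 (q k) x) u \<le> 0" if k: "k \<in> I" "q k x = Q x" for k
    proof (rule LIMSEQ_le)
      show "(\<lambda>n. (q k (x + t n *\<^sub>R w n) - q k x) / t n) \<longlonglongrightarrow> blinfun_apply (deriv1 (q k) x) u"
        by (rule has_derivative_sequential_quotient[OF
              twice_frechet_differentiable_imp_has_derivative[OF q[OF k(1)]] t t0 w])
      have "(\<lambda>n. t n * (1 / cs n - B / 2)) \<longlonglongrightarrow> 0 * (0 - B / 2)"
        by (intro tendsto_intros t0 inv_cs)
      then show "(\<lambda>n. t n * (1 / cs n - B / 2)) \<longlonglongrightarrow> 0" by simp
      have "(q k (x + t n *\<^sub>R w n) - q k x) / t n \<le> t n * (1 / cs n - B / 2)" for n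
      proof -
        have "(q k (x + t n *\<^sub>R w n) - q k x) / (t n)\<^sup>2 \<le> (Q (x + t n *\<^sub>R w n) - Q x) / (t n)\<^sup>2"
          using q_le[OF k(1)] k(2) by (intro divide_right_mono) auto
        also have "\<dots> \<le> 1 / cs n - B / 2"
          using key[of n] below[OF cs1 nw, of n n] by simp
        finally have "t n * ((q k (x + t n *\<^sub>R w n) - q k x) / (t n)\<^sup>2) \<le> t n * (1 / cs n - B / 2)"
          using t[of n] by (intro mult_left_mono) auto
        then show ?thesis using t[of n] by (simp add: power2_eq_square)
      qed
      then show "\<exists>N. \<forall>n\<ge>N. (q k (x + t n *\<^sub>R w n) - q k x) / t n \<le> t n * (1 / cs n - B / 2)"
        by blast
    qed
    fix \<alpha> :: "'i \<Rightarrow> real"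
    assume \<alpha>: "\<And>k. \<alpha> k \<ge> 0" "\<And>k. q k x \<noteq> Q x \<Longrightarrow> \<alpha> k = 0" "sum \<alpha> I = 1"
      and stat: "\<And>h. x + h \<in> A \<Longrightarrow> 0 \<le> blinfun_apply (deriv1 (\<lambda>z. \<Sum>k\<in>I. \<alpha> k * q k z) x) h"
    \<comment> \<open>The weighted average lies below the maximum everywhere and touches it at
      \<open>x\<close>, because the weights live on active indices. It is a smooth minorant to which
      the Taylor formula applies.\<close>
    define p where "p z = (\<Sum>k\<in>I. \<alpha> k * q k z)" for z
    have p2: "twice_frechet_differentiable p x"
      unfolding p_def by (intro twice_frechet_differentiable_sum twice_frechet_differentiable_cmult q)
    have p_le: "p z \<le> Q z" for z
    proof -
      have "p z \<le> (\<Sum>k\<in>I. \<alpha> k * Q z)"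
        unfolding p_def using q_le \<alpha>(1) by (intro sum_mono mult_left_mono) auto
      then show ?thesis using \<alpha>(3) by (simp add: sum_distrib_right[symmetric])
    qed
    have px: "p x = Q x"
    proof -
      have "p x = (\<Sum>k\<in>I. \<alpha> k * Q x)"
        unfolding p_def using \<alpha>(2) by (intro sum.cong) auto
      then show ?thesis using \<alpha>(3) by (simp add: sum_distrib_right[symmetric])
    qed
    obtain D' where D': "(deriv1 p has_derivative D') (at x)"
      "\<And>h k. deriv2 p x h k = blinfun_apply (D' h) k"
      using p2 by (rule twice_frechet_differentiableE) blast
    interpret D': bounded_linear D' using D'(1) by (rule has_derivative_bounded_linear)
    define e where "e n = (p (x + t n *\<^sub>R w n) - p x - blinfun_apply (deriv1 p x) (t n *\<^sub>R w n)
        - deriv2 p x (t n *\<^sub>R w n) (t n *\<^sub>R w n) / 2) / (norm (t n *\<^sub>R w n))\<^sup>2" for n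
    have tw0: "filterlim (\<lambda>n. t n *\<^sub>R w n) (at 0) sequentially"
      using tendsto_scaleR[OF t0 w] h(1) by (auto simp: filterlim_at tw)
    have e0: "e \<longlonglongrightarrow> 0"
      unfolding e_def using filterlim_compose[OF second_order_taylor[OF p2] tw0] .
    have lim: "(\<lambda>n. 2 / cs n - 2 * e n - deriv2 p x (w n) (w n)) \<longlonglongrightarrow> - deriv2 p x u u"
    proof -
      have "(\<lambda>n. 2 * (1 / cs n) - 2 * e n - blinfun_apply (D' (w n)) (w n))
          \<longlonglongrightarrow> 2 * 0 - 2 * 0 - blinfun_apply (D' u) u"
        by (intro tendsto_intros inv_cs e0 D'.tendsto w)
      then show ?thesis by (simp add: D'(2))
    qed
    have "\<omega> (cs n) (w n) \<le> 2 / cs n - 2 * e n - deriv2 p x (w n) (w n)" for n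
    proof -
      \<comment> \<open>The first order term divided by \<open>(t n)\<^sup>2\<close> need not
        converge. Its sign, known since the violating point lies in \<open>A\<close>, allows it to
        be dropped.\<close>
      have "0 \<le> blinfun_apply (deriv1 p x) (t n *\<^sub>R w n)"
        using stat[of "h (s n)"] h(2) by (simp add: tw p_def[abs_def])
      then have 1: "0 \<le> blinfun_apply (deriv1 p x) (t n *\<^sub>R w n) / (t n)\<^sup>2" by simp
      have "e n = (p (x + t n *\<^sub>R w n) - p x) / (t n)\<^sup>2
          - blinfun_apply (deriv1 p x) (t n *\<^sub>R w n) / (t n)\<^sup>2 - deriv2 p x (w n) (w n) / 2"
        using t[of n] nw[of n]
        by (simp add: e_def D'(2) D'.scaleR blinfun.scaleR_left blinfun.scaleR_right
            diff_divide_distrib power2_eq_square)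
      moreover have "(p (x + t n *\<^sub>R w n) - p x) / (t n)\<^sup>2 \<le> (Q (x + t n *\<^sub>R w n) - Q x) / (t n)\<^sup>2"
        using p_le px by (intro divide_right_mono) auto
      moreover have "2 / cs n = 2 * (1 / cs n)" by simp
      ultimately show ?thesis using key[of n] 1 by linarith
    qed
    then have "limsup (\<lambda>n. ereal (\<omega> (cs n) (w n)))
        \<le> limsup (\<lambda>n. ereal (2 / cs n - 2 * e n - deriv2 p x (w n) (w n)))"
      by (intro Limsup_mono) auto
    also have "\<dots> = ereal (- deriv2 p x u u)"
      using lim by (intro lim_imp_Limsup) auto
    finally show "limsup (\<lambda>n. ereal (\<omega> (cs n) (w n)))
        \<le> ereal (- deriv2 (\<lambda>z. \<Sum>k\<in>I. \<alpha> k * q k z) x u u)"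
      by (simp add: p_def[abs_def])
  qed (use us(1) w cs in auto)
qed


section \<open>Contingent cones and homogeneous functions of degree 2\<close>

lemma convex_diff_in_contingent_cone:
  assumes "convex A" "x \<in> A" "x + h \<in> A"
  shows "h \<in> contingent_cone A x"
proof -
  have "x + inverse (real (Suc n)) *\<^sub>R h \<in> A" for n
  proof -
    have "(1 - inverse (real (Suc n))) *\<^sub>R x + inverse (real (Suc n)) *\<^sub>R (x + h) \<in> A"
      using assms by (intro convexD) (auto simp: field_simps)
    then show ?thesis by (simp add: algebra_simps)
  qed
  then show ?thesis
    unfolding contingent_cone_def
    by (auto intro!: exI[of _ "\<lambda>n. inverse (real (Suc n))"] exI[of _ "\<lambda>n. h"]
        LIMSEQ_inverse_real_of_nat simp del: of_nat_Suc)
qed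

text \<open>Linearity cancels the positive step lengths, and continuity passes to the limit
  direction.\<close>

lemma nonneg_on_contingent_cone:
  assumes D: "bounded_linear D" and nonneg: "\<And>h. x + h \<in> A \<Longrightarrow> 0 \<le> (D h :: real)"
    and h: "h \<in> contingent_cone A x"
  shows "0 \<le> D h"
proof -
  interpret D: bounded_linear D by fact
  obtain t hs where t: "\<And>n. t n > (0::real)" "hs \<longlonglongrightarrow> h" "\<And>n::nat. x + t n *\<^sub>R hs n \<in> A"
    using h by (auto simp: contingent_cone_def)
  have "0 \<le> D (hs n)" for n
    using nonneg[OF t(3), of n] t(1)[of n] by (simp add: D.scaleR zero_le_mult_iff)
  then show ?thesis using D.tendsto[OF t(2)] by (intro LIMSEQ_le_const) auto
qed

text \<open>Continuity of \<open>w\<close> on the sphere is not assumed, so compactness gives no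
  bound. Smallness on a sphere of radius \<open>d / 2\<close> is rescaled to the unit sphere
  instead.\<close>

lemma pos_homogeneous2_bounded_below:
  fixes w :: "'a::real_normed_vector \<Rightarrow> real"
  assumes hom: "pos_homogeneous2 w" and lim: "(w \<longlongrightarrow> 0) (at 0)"
  obtains B where "\<And>u. norm u = 1 \<Longrightarrow> B \<le> w u"
proof -
  have "\<forall>\<^sub>F h in at 0. dist (w h) 0 < 1" using lim by (rule tendstoD) simp
  then obtain d where d: "d > 0" "\<And>h. h \<noteq> 0 \<Longrightarrow> norm h < d \<Longrightarrow> \<bar>w h\<bar> < 1"
    by (auto simp: eventually_at)
  have "- 1 / (d / 2)\<^sup>2 \<le> w u" if "norm u = 1" for u
  proof -
    have "\<bar>w ((d / 2) *\<^sub>R u)\<bar> < 1" using d that by (intro d(2)) auto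
    moreover have "w ((d / 2) *\<^sub>R u) = (d / 2)\<^sup>2 * w u"
      using hom d(1) unfolding pos_homogeneous2_def by simp
    ultimately have "- 1 \<le> (d / 2)\<^sup>2 * w u" by linarith
    then show ?thesis using d(1) by (subst pos_divide_le_eq) (auto simp: mult.commute)
  qed
  then show thesis by (rule that)
qed

text \<open>Along the ray through \<open>u\<close> both homogeneous terms scale like the squared
  step length, while the remainders vanish after division by it.\<close>

lemma pos_homogeneous2_le_of_expansion:
  fixes w1 w2 \<rho>1 \<rho>2 :: "'a::real_normed_vector \<Rightarrow> real"
  assumes hom: "pos_homogeneous2 w1" "pos_homogeneous2 w2"
    and \<rho>: "((\<lambda>h. \<rho>1 h / (norm h)\<^sup>2) \<longlongrightarrow> 0) (at 0)" "((\<lambda>h. \<rho>2 h / (norm h)\<^sup>2) \<longlongrightarrow> 0) (at 0)"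
    and le: "\<forall>\<^sub>F h in nhds 0. w1 h / 2 + \<rho>1 h \<le> w2 h / 2 + \<rho>2 h"
    and u: "norm u = 1"
  shows "w1 u \<le> w2 u"
proof -
  define t where "t n = inverse (real (Suc n))" for n
  have t: "t n > 0" for n by (simp add: t_def)
  have tu: "(\<lambda>n. t n *\<^sub>R u) \<longlonglongrightarrow> 0"
    using tendsto_scaleR[OF LIMSEQ_inverse_real_of_nat tendsto_const, of u] by (simp add: t_def)
  have tu0: "filterlim (\<lambda>n. t n *\<^sub>R u) (at 0) sequentially"
    using tu t u by (auto simp: filterlim_at less_imp_neq[THEN not_sym])
  have "(\<lambda>n. 2 * (\<rho>1 (t n *\<^sub>R u) / (norm (t n *\<^sub>R u))\<^sup>2 - \<rho>2 (t n *\<^sub>R u) / (norm (t n *\<^sub>R u))\<^sup>2))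
      \<longlonglongrightarrow> 2 * (0 - 0)"
    by (intro tendsto_intros filterlim_compose[OF \<rho>(1) tu0] filterlim_compose[OF \<rho>(2) tu0])
  moreover have "\<forall>\<^sub>F n in sequentially. 2 * (\<rho>1 (t n *\<^sub>R u) / (norm (t n *\<^sub>R u))\<^sup>2
      - \<rho>2 (t n *\<^sub>R u) / (norm (t n *\<^sub>R u))\<^sup>2) \<le> w2 u - w1 u"
    using tu[unfolded filterlim_def le_filter_def, rule_format, OF le, unfolded eventually_filtermap]
  proof eventually_elim
    case (elim n)
    have "w1 (t n *\<^sub>R u) = (t n)\<^sup>2 * w1 u" "w2 (t n *\<^sub>R u) = (t n)\<^sup>2 * w2 u"
      using hom t[of n] by (auto simp: pos_homogeneous2_def)
    then have "2 * (\<rho>1 (t n *\<^sub>R u) - \<rho>2 (t n *\<^sub>R u)) \<le> (w2 u - w1 u) * (t n)\<^sup>2"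
      using elim by (simp add: algebra_simps)
    then have "2 * (\<rho>1 (t n *\<^sub>R u) - \<rho>2 (t n *\<^sub>R u)) / (t n)\<^sup>2 \<le> w2 u - w1 u"
      using t[of n] by (simp add: pos_divide_le_eq)
    then show ?case using t[of n] u by (simp add: diff_divide_distrib)
  qed
  ultimately have "2 * (0 - 0) \<le> w2 u - w1 u"
    by (intro tendsto_upperbound[where F = sequentially]) auto
  then show ?thesis by simp
qed

section \<open>Real-valued forms of the objective and of \<open>lagrangian0\<close>\<close>

lemma max_fun_eq_Max_real:
  assumes "m \<ge> 1" and "\<forall>k\<in>{1..m}. \<bar>f k z\<bar> \<noteq> \<infinity>"
  shows "max_fun m f z = ereal (Max ((\<lambda>k. real_of_ereal (f k z)) ` {1..m}))"
proof -
  have "(\<lambda>k. f k z) ` {1..m} = ereal ` (\<lambda>k. real_of_ereal (f k z)) ` {1..m}"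
    unfolding image_image using assms(2) by (intro image_cong) (auto simp: ereal_real)
  then show ?thesis
    unfolding max_fun_def using assms(1)
    by (simp add: mono_Max_commute[of ereal] mono_def)
qed

text \<open>Since the weights sum to 1, the constraint term can be distributed over the summands,
  which presents the Lagrangian as a weighted average of the functions entering the maximum.\<close>

lemma lagrangian0_eq_real:
  assumes "\<forall>k\<in>{1..m}. \<bar>f k z\<bar> \<noteq> \<infinity>" and "(\<Sum>k=1..m. \<alpha> k) = 1"
  shows "lagrangian0 m f G z \<mu> \<alpha>
    = ereal (\<Sum>k=1..m. \<alpha> k * (real_of_ereal (f k z) + blinfun_apply \<mu> (G z)))"
proof -
  have "(\<Sum>k=1..m. ereal (\<alpha> k) * f k z) = (\<Sum>k=1..m. ereal (\<alpha> k * real_of_ereal (f k z)))"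
    using assms(1) by (intro sum.cong) (auto simp: ereal_real simp flip: times_ereal.simps(1))
  then show ?thesis
    using assms(2)
    by (simp add: lagrangian0_def distrib_left sum.distrib flip: sum_distrib_right)
qed

lemma admits_second_order_expansionE:
  assumes "admits_second_order_expansion \<Phi> G A K xs ls \<mu>s"
  obtains \<omega> where "\<And>c. c > 0 \<Longrightarrow> pos_homogeneous2 (\<omega> c)"
    "\<And>c. c > 0 \<Longrightarrow> \<exists>r. ((\<lambda>h. r h / (norm h)\<^sup>2) \<longlongrightarrow> 0) (at 0) \<and>
      (\<forall>\<^sub>F h in nhds 0. \<Phi> (G (xs + h)) ls c - \<Phi> (G xs) ls c =
         ereal (blinfun_apply \<mu>s (frechet_derivative G (at xs) h)
            + blinfun_apply \<mu>s (deriv2 G xs h h) / 2 + \<omega> c h / 2 + r h))"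
    "\<And>h hs cs. h \<in> contingent_cone A xs \<Longrightarrow> hs \<longlonglongrightarrow> h \<Longrightarrow> filterlim cs at_top sequentially \<Longrightarrow>
       \<bar>limsup (\<lambda>n. ereal (\<omega> (cs n) (hs n)))\<bar> \<noteq> \<infinity> \<Longrightarrow>
       h \<in> critical_cone G A K xs \<mu>s \<and>
       limsup (\<lambda>n. ereal (\<omega> (cs n) (hs n))) \<ge> - support_fun \<mu>s (curvature_set G K xs h)"
  using assms unfolding admits_second_order_expansion_def
  apply (elim exE conjE)
  subgoal for \<omega> by (rule that[of \<omega>]; simp)
  done

section \<open>The local saddle point property\<close>

theorem theorem2:
  fixes A :: "(real ^ 'd) set"
    and K :: "'y::real_normed_vector set"
    and \<Lambda> :: "('y \<Rightarrow>\<^sub>L real) set"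
    and m :: nat
    and f :: "nat \<Rightarrow> real ^ 'd \<Rightarrow> ereal"
    and G :: "real ^ 'd \<Rightarrow> 'y"
    and \<Phi> :: "'y \<Rightarrow> ('y \<Rightarrow>\<^sub>L real) \<Rightarrow> real \<Rightarrow> ereal"
    and \<Phi>0 :: "('y \<Rightarrow>\<^sub>L real) \<Rightarrow> ('y \<Rightarrow>\<^sub>L real)"
    and xs :: "real ^ 'd"
    and \<mu>s ls :: "'y \<Rightarrow>\<^sub>L real"
  assumes A: "A \<noteq> {}" "convex A"
    and K: "convex_cone K" "closed K"
    and Lam: "convex_cone \<Lambda>" "closed \<Lambda>"
    and m: "m \<ge> 1"
    and f_proper: "\<And>k x. k \<in> {1..m} \<Longrightarrow> f k x \<noteq> -\<infinity>"
    and Phi_proper: "\<And>y l c. c > 0 \<Longrightarrow> \<Phi> y l c \<noteq> -\<infinity>"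
    and feasible: "\<exists>x \<in> feasible_set A G K. max_fun m f x < \<infinity>"
    and solvable: "\<exists>x. globally_optimal (max_fun m f) (feasible_set A G K) x"
    and A2: "\<And>y l c. y \<in> K \<Longrightarrow> l \<in> \<Lambda> \<Longrightarrow> c > 0 \<Longrightarrow> \<Phi> y l c \<le> 0"
    and A4: "\<And>y l. l \<in> \<Lambda> \<Longrightarrow> mono_on {0<..} (\<Phi> y l)"
    and A10: "\<And>y l c. y \<in> K \<Longrightarrow> l \<in> polar_cone K \<Longrightarrow> c > 0 \<Longrightarrow> blinfun_apply l y = 0 \<Longrightarrow>
                \<Phi> y l c = 0"
    and A11_deriv: "\<And>y l c. y \<in> K \<Longrightarrow> l \<in> polar_cone K \<Longrightarrow> c > 0 \<Longrightarrow> blinfun_apply l y = 0 \<Longrightarrow>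
                has_frechet_deriv_ereal (\<lambda>z. \<Phi> z l c) (\<Phi>0 l) y"
    and A11_surj: "\<Phi>0 ` polar_cone K = polar_cone K"
    and A11_iff: "\<And>y l. y \<in> K \<Longrightarrow> l \<in> polar_cone K \<Longrightarrow>
                blinfun_apply (\<Phi>0 l) y = 0 \<longleftrightarrow> blinfun_apply l y = 0"
    and loc_opt: "locally_optimal (max_fun m f) (feasible_set A G K) xs"
    and f_diff: "\<And>k. k \<in> {1..m} \<Longrightarrow> twice_frechet_differentiable_ereal (f k) xs"
    and G_diff: "twice_frechet_differentiable G xs"
    and kkt: "kkt_pair (max_fun m f) G A K xs \<mu>s"
    and sosc: "second_order_sufficient m f G A K xs \<mu>s"
    and ls: "ls \<in> polar_cone K" "ls \<in> \<Lambda>" "\<Phi>0 ls = \<mu>s"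
    and expansion: "admits_second_order_expansion \<Phi> G A K xs ls \<mu>s"
  shows "local_saddle_point A \<Lambda> (aug_lagrangian (max_fun m f) G \<Phi>) xs ls"
proof -
  define I where "I = {1..m}"
  define g where "g z = blinfun_apply \<mu>s (G z)" for z
  define r where "r k z = real_of_ereal (f k z)" for k z
  \<comment> \<open>The constraint term is absorbed into each component: near \<open>xs\<close>,
    \<open>Q\<close> is the Lagrangian, and \<open>P \<alpha>\<close> is \<open>lagrangian0\<close>
    for weights with sum 1.\<close>
  define q where "q k z = r k z + g z" for k z
  define R where "R z = Max ((\<lambda>k. r k z) ` I)" for z
  define Q where "Q z = Max ((\<lambda>k. q k z) ` I)" for z
  define P where "P \<alpha> z = (\<Sum>k\<in>I. \<alpha> k * q k z)" for \<alpha> z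
  have I: "finite I" "I \<noteq> {}" using m by (auto simp: I_def)
  have Q_eq: "Q z = R z + g z" for z
    unfolding Q_def R_def q_def by (rule Max_add_commute[OF I])

  have xs: "xs \<in> A" "G xs \<in> K" "\<mu>s \<in> polar_cone K" "g xs = 0"
    and kkt_dir: "\<And>h. h \<in> contingent_cone A xs \<Longrightarrow>
      \<exists>d\<ge>0. has_directional_deriv (\<lambda>z. lagrangian (max_fun m f) G z \<mu>s) xs h d"
    using kkt by (auto simp: kkt_pair_def g_def)
  \<comment> \<open>Complementarity holds for \<open>\<mu>s\<close> by the KKT conditions and passes
    to \<open>ls\<close> by (A11). With (A10) the augmenting term vanishes at \<open>xs\<close> for
    every parameter.\<close>
  have ls0: "blinfun_apply ls (G xs) = 0"
    using A11_iff[OF xs(2) ls(1)] ls(3) xs(4) by (simp add: g_def)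
  have \<Phi>_xs: "\<Phi> (G xs) ls c = 0" if "c > 0" for c
    using A10[OF xs(2) ls(1) that ls0] .

  have fin: "\<forall>\<^sub>F z in nhds xs. \<forall>k\<in>{1..m}. \<bar>f k z\<bar> \<noteq> \<infinity>"
    using f_diff by (intro eventually_ball_finite)
      (auto simp: twice_frechet_differentiable_ereal_def finite_near_def)
  have F_eq: "max_fun m f z = ereal (R z)" if "\<forall>k\<in>{1..m}. \<bar>f k z\<bar> \<noteq> \<infinity>" for z
    using max_fun_eq_Max_real[of m f z, OF m that] by (simp add: R_def r_def I_def)
  have fin_xs: "\<forall>k\<in>{1..m}. \<bar>f k xs\<bar> \<noteq> \<infinity>"
    using eventually_nhds_x_imp_x[OF fin] .
  have g2: "twice_frechet_differentiable g xs"
    and g_deriv1: "blinfun_apply (deriv1 g xs) h = blinfun_apply \<mu>s (frechet_derivative G (at xs) h)"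
    and g_deriv2: "deriv2 g xs h h = blinfun_apply \<mu>s (deriv2 G xs h h)" for h
    using twice_frechet_differentiable_compose_blinfun[OF G_diff, of \<mu>s]
      frechet_derivative_at[OF twice_frechet_differentiable_imp_has_derivative[OF G_diff]]
    by (simp_all add: g_def[abs_def])
  have q2: "twice_frechet_differentiable (q k) xs" if "k \<in> I" for k
    using f_diff[of k] that g2 unfolding q_def r_def I_def
    by (intro twice_frechet_differentiable_add) (auto simp: twice_frechet_differentiable_ereal_def)
  note q_deriv = twice_frechet_differentiable_imp_has_derivative[OF q2]
  have P2: "twice_frechet_differentiable (P \<alpha>) xs" for \<alpha>
    unfolding P_def by (intro twice_frechet_differentiable_sum twice_frechet_differentiable_cmult q2)
  have P_deriv1: "blinfun_apply (deriv1 (P \<alpha>) xs) h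
      = (\<Sum>k\<in>I. \<alpha> k * blinfun_apply (deriv1 (q k) xs) h)" for \<alpha> h
  proof -
    have "(P \<alpha> has_derivative (\<lambda>h. \<Sum>k\<in>I. \<alpha> k * blinfun_apply (deriv1 (q k) xs) h)) (at xs)"
      unfolding P_def[abs_def]
      by (intro has_derivative_sum has_derivative_mult_right q_deriv)
    from has_derivative_unique[OF this twice_frechet_differentiable_imp_has_derivative[OF P2]]
    show ?thesis by metis
  qed

  have lagr: "\<forall>\<^sub>F z in nhds xs. lagrangian (max_fun m f) G z \<mu>s = ereal (Max ((\<lambda>k. q k z) ` I))"
    using fin
    by eventually_elim (simp add: lagrangian_def F_eq Q_eq[unfolded Q_def] g_def)
  have active: "active_set m f xs = {k \<in> I. q k xs = Q xs}"
  proof -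
    have "f k xs = max_fun m f xs \<longleftrightarrow> q k xs = Q xs" if "k \<in> I" for k
    proof -
      have "f k xs = ereal (r k xs)" using fin_xs that by (auto simp: r_def I_def ereal_real)
      then show ?thesis by (simp add: F_eq[OF fin_xs] q_def Q_eq)
    qed
    then show ?thesis by (auto simp: active_set_def I_def)
  qed
  have lagr0: "frechet_derivative (\<lambda>z. real_of_ereal (lagrangian0 m f G z \<mu>s \<alpha>)) (at xs)
        = blinfun_apply (deriv1 (P \<alpha>) xs)"
    "deriv2 (\<lambda>z. real_of_ereal (lagrangian0 m f G z \<mu>s \<alpha>)) xs h h = deriv2 (P \<alpha>) xs h h"
    if "sum \<alpha> {1..m} = 1" for \<alpha> h
  proof -
    have "\<forall>\<^sub>F z in nhds xs. P \<alpha> z = real_of_ereal (lagrangian0 m f G z \<mu>s \<alpha>)"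
      using fin
      by eventually_elim
        (simp add: lagrangian0_eq_real[OF _ that] P_def q_def r_def g_def I_def del: One_nat_def)
    note eq = twice_frechet_differentiable_cong[OF P2 this]
    show "deriv2 (\<lambda>z. real_of_ereal (lagrangian0 m f G z \<mu>s \<alpha>)) xs h h = deriv2 (P \<alpha>) xs h h"
      by (rule eq(3))
    show "frechet_derivative (\<lambda>z. real_of_ereal (lagrangian0 m f G z \<mu>s \<alpha>)) (at xs)
        = blinfun_apply (deriv1 (P \<alpha>) xs)"
      using frechet_derivative_at[OF twice_frechet_differentiable_imp_has_derivative[OF eq(1)]]
      by (simp add: eq(2))
  qed

  have multiplier_ex: "\<exists>\<alpha>. \<alpha> \<in> objective_multipliers m f G A xs \<mu>s"
  proof -
    define J where "J = {k \<in> I. q k xs = Q xs}"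
    \<comment> \<open>The adjoint applied to 1 is the gradient of \<open>q k\<close>, so derivatives
      become inner products.\<close>
    define v where "v k = adjoint (blinfun_apply (deriv1 (q k) xs)) 1" for k
    have v: "v k \<bullet> h = blinfun_apply (deriv1 (q k) xs) h" for k h
      using adjoint_works[OF blinfun.bounded_linear_right[THEN bounded_linear.linear],
          of h "deriv1 (q k) xs" 1] by (simp add: v_def inner_commute)
    have "Q xs \<in> (\<lambda>k. q k xs) ` I" unfolding Q_def using I by (intro Max_in) auto
    then have J: "finite J" "J \<noteq> {}" "J \<subseteq> I" using I by (auto simp: J_def)
    \<comment> \<open>The translate of \<open>A\<close> inherits convexity directly. The inequality
      obtained on it is later extended to the contingent cone.\<close>
    define B where "B = {h. xs + h \<in> A}"
    have "convex B"
    proof (rule convexI)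
      fix y z and a b :: real
      assume yz: "y \<in> B" "z \<in> B" and ab: "0 \<le> a" "0 \<le> b" "a + b = 1"
      have "a *\<^sub>R (xs + y) + b *\<^sub>R (xs + z) = (a + b) *\<^sub>R xs + (a *\<^sub>R y + b *\<^sub>R z)"
        by (simp add: algebra_simps)
      then show "a *\<^sub>R y + b *\<^sub>R z \<in> B"
        using convexD[OF A(2), of "xs + y" "xs + z" a b] yz ab by (simp add: B_def)
    qed
    moreover have "B \<noteq> {}" using xs(1) by (auto simp: B_def intro!: exI[of _ 0])
    \<comment> \<open>The KKT directional derivative is nonnegative and equals the derivative of
      some active \<open>q k\<close>.\<close>
    moreover have "\<exists>k\<in>J. v k \<bullet> h \<ge> 0" if "h \<in> B" for h
    proof -
      have "h \<in> contingent_cone A xs"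
        using that by (auto simp: B_def intro: convex_diff_in_contingent_cone[OF A(2) xs(1)])
      from kkt_dir[OF this] obtain d where d: "d \<ge> 0"
        "has_directional_deriv (\<lambda>z. lagrangian (max_fun m f) G z \<mu>s) xs h d" by blast
      from directional_deriv_of_Max[OF I q_deriv lagr d(2)] obtain k where
        "k \<in> I" "q k xs = Q xs" "d = ereal (blinfun_apply (deriv1 (q k) xs) h)"
        unfolding Q_def by blast
      then show ?thesis using d(1) by (auto simp: J_def v)
    qed
    ultimately obtain \<alpha> where \<alpha>: "\<And>k. \<alpha> k \<ge> 0" "\<And>k. k \<notin> J \<Longrightarrow> \<alpha> k = 0" "sum \<alpha> J = 1"
      "\<And>h. h \<in> B \<Longrightarrow> (\<Sum>k\<in>J. \<alpha> k * (v k \<bullet> h)) \<ge> 0"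
      by (rule exists_convex_multipliers[OF J(1,2)]) blast+
    have sum1: "sum \<alpha> {1..m} = 1"
      using sum.mono_neutral_left[OF I(1) J(3), of \<alpha>] \<alpha>(2,3) by (auto simp: I_def)
    have "0 \<le> blinfun_apply (deriv1 (P \<alpha>) xs) h" if "xs + h \<in> A" for h
    proof -
      have "(\<Sum>k\<in>J. \<alpha> k * (v k \<bullet> h)) = (\<Sum>k\<in>I. \<alpha> k * (v k \<bullet> h))"
        using \<alpha>(2) by (intro sum.mono_neutral_left I J) auto
      then show ?thesis using \<alpha>(4)[of h] that by (simp add: P_deriv1 v B_def)
    qed
    then have "0 \<le> blinfun_apply (deriv1 (P \<alpha>) xs) h" if "h \<in> contingent_cone A xs" for h
      using nonneg_on_contingent_cone[OF blinfun.bounded_linear_right _ that] by blast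
    then have "\<alpha> \<in> objective_multipliers m f G A xs \<mu>s"
      unfolding objective_multipliers_def active using \<alpha> sum1 lagr0(1)[OF sum1] by (auto simp: J_def)
    then show ?thesis by blast
  qed

  obtain \<omega> where \<omega>: "\<And>c. c > 0 \<Longrightarrow> pos_homogeneous2 (\<omega> c)"
    "\<And>c. c > 0 \<Longrightarrow> \<exists>r. ((\<lambda>h. r h / (norm h)\<^sup>2) \<longlongrightarrow> 0) (at 0) \<and>
      (\<forall>\<^sub>F h in nhds 0. \<Phi> (G (xs + h)) ls c - \<Phi> (G xs) ls c =
         ereal (blinfun_apply \<mu>s (frechet_derivative G (at xs) h)
            + blinfun_apply \<mu>s (deriv2 G xs h h) / 2 + \<omega> c h / 2 + r h))"
    "\<And>h hs cs. h \<in> contingent_cone A xs \<Longrightarrow> hs \<longlonglongrightarrow> h \<Longrightarrow> filterlim cs at_top sequentially \<Longrightarrow>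
       \<bar>limsup (\<lambda>n. ereal (\<omega> (cs n) (hs n)))\<bar> \<noteq> \<infinity> \<Longrightarrow>
       h \<in> critical_cone G A K xs \<mu>s \<and>
       limsup (\<lambda>n. ereal (\<omega> (cs n) (hs n))) \<ge> - support_fun \<mu>s (curvature_set G K xs h)"
    by (rule admits_second_order_expansionE[OF expansion]) blast+
  \<comment> \<open>Taylor's formula for \<open>g\<close> replaces the first and second order terms
    of the expansion by \<open>g (xs + h)\<close> itself; its remainder \<open>T\<close> is moved
    into \<open>\<rho>\<close>.\<close>
  have "\<exists>\<rho>. ((\<lambda>h. \<rho> h / (norm h)\<^sup>2) \<longlongrightarrow> 0) (at 0) \<and>
      (\<forall>\<^sub>F h in nhds 0. \<Phi> (G (xs + h)) ls c = ereal (g (xs + h) + \<omega> c h / 2 + \<rho> h))"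
    if c: "c > 0" for c
  proof -
    obtain \<rho> where \<rho>: "((\<lambda>h. \<rho> h / (norm h)\<^sup>2) \<longlongrightarrow> 0) (at 0)"
      "\<forall>\<^sub>F h in nhds 0. \<Phi> (G (xs + h)) ls c - \<Phi> (G xs) ls c =
         ereal (blinfun_apply \<mu>s (frechet_derivative G (at xs) h)
            + blinfun_apply \<mu>s (deriv2 G xs h h) / 2 + \<omega> c h / 2 + \<rho> h)"
      using \<omega>(2)[OF c] by blast
    define T where "T h = g (xs + h) - g xs - blinfun_apply (deriv1 g xs) h - deriv2 g xs h h / 2" for h
    have "((\<lambda>h. T h / (norm h)\<^sup>2) \<longlongrightarrow> 0) (at 0)"
      unfolding T_def by (rule second_order_taylor[OF g2])
    then have "((\<lambda>h. (\<rho> h - T h) / (norm h)\<^sup>2) \<longlongrightarrow> 0) (at 0)"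
      using tendsto_diff[OF \<rho>(1)] by (fastforce simp: diff_divide_distrib)
    moreover have "\<forall>\<^sub>F h in nhds 0. \<Phi> (G (xs + h)) ls c
        = ereal (g (xs + h) + \<omega> c h / 2 + (\<rho> h - T h))"
      using \<rho>(2) by eventually_elim (simp add: \<Phi>_xs[OF c] T_def g_deriv1 g_deriv2 xs(4))
    ultimately show ?thesis by (intro exI[of _ "\<lambda>h. \<rho> h - T h"] conjI)
  qed
  then have "\<forall>c\<in>{0<..}. \<exists>\<rho>. ((\<lambda>h. \<rho> h / (norm h)\<^sup>2) \<longlongrightarrow> 0) (at 0) \<and>
      (\<forall>\<^sub>F h in nhds 0. \<Phi> (G (xs + h)) ls c = ereal (g (xs + h) + \<omega> c h / 2 + \<rho> h))"
    by simp
  from bchoice[OF this] obtain \<rho> where \<rho>: "\<And>c. c > 0 \<Longrightarrow> ((\<lambda>h. \<rho> c h / (norm h)\<^sup>2) \<longlongrightarrow> 0) (at 0)"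
    and \<Phi>_eq: "\<And>c. c > 0 \<Longrightarrow>
      \<forall>\<^sub>F h in nhds 0. \<Phi> (G (xs + h)) ls c = ereal (g (xs + h) + \<omega> c h / 2 + \<rho> c h)"
    by auto

  have mono: "\<Phi> y ls c \<le> \<Phi> y ls c'" if "0 < c" "c \<le> c'" for y c c'
    using A4[OF ls(2), of y] that by (auto simp: mono_on_def)
  \<comment> \<open>Monotonicity in the parameter, read off the two expansions, makes a lower bound
    for \<open>\<omega> 1\<close> on the sphere uniform in \<open>c\<close>.\<close>
  have \<omega>_mono: "\<omega> 1 u \<le> \<omega> c u" if "c \<ge> 1" "norm u = 1" for c u
  proof (rule pos_homogeneous2_le_of_expansion[OF \<omega>(1) \<omega>(1) \<rho> \<rho> _ that(2)])
    have "\<forall>\<^sub>F h in nhds 0. \<Phi> (G (xs + h)) ls c = ereal (g (xs + h) + \<omega> c h / 2 + \<rho> c h)"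
      using \<Phi>_eq that by simp
    moreover have "\<forall>\<^sub>F h in nhds 0. \<Phi> (G (xs + h)) ls 1 = ereal (g (xs + h) + \<omega> 1 h / 2 + \<rho> 1 h)"
      using \<Phi>_eq by simp
    ultimately show "\<forall>\<^sub>F h in nhds 0. \<omega> 1 h / 2 + \<rho> 1 h \<le> \<omega> c h / 2 + \<rho> c h"
    proof eventually_elim
      case (elim h)
      then show ?case using mono[of 1 c "G (xs + h)"] that(1) by simp
    qed
  qed (use that in auto)
  \<comment> \<open>The expansion is solved for \<open>\<omega> 1\<close>; all other terms tend to
    0, the augmenting term because (A11) makes it continuous at \<open>G xs\<close>.\<close>
  have "(\<omega> 1 \<longlongrightarrow> 0) (at 0)"
  proof -
    have shift: "((\<lambda>h. xs + h) \<longlongrightarrow> xs) (at 0)" by (auto intro!: tendsto_eq_intros)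
    have "isCont (\<lambda>z. real_of_ereal (\<Phi> z ls 1)) (G xs)"
      using A11_deriv[OF xs(2) ls(1) zero_less_one ls0]
      by (auto simp: has_frechet_deriv_ereal_def intro: has_derivative_continuous)
    moreover have "((\<lambda>h. G (xs + h)) \<longlongrightarrow> G xs) (at 0)"
      by (rule isCont_tendsto_compose[OF _ shift])
        (rule has_derivative_continuous[OF twice_frechet_differentiable_imp_has_derivative[OF G_diff]])
    ultimately have "((\<lambda>h. real_of_ereal (\<Phi> (G (xs + h)) ls 1)) \<longlongrightarrow> real_of_ereal (\<Phi> (G xs) ls 1)) (at 0)"
      by (rule isCont_tendsto_compose)
    then have 1: "((\<lambda>h. real_of_ereal (\<Phi> (G (xs + h)) ls 1)) \<longlongrightarrow> 0) (at 0)"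
      by (simp add: \<Phi>_xs)
    have 2: "((\<lambda>h. g (xs + h)) \<longlongrightarrow> 0) (at 0)"
      using isCont_tendsto_compose[OF has_derivative_continuous[OF
            twice_frechet_differentiable_imp_has_derivative[OF g2]] shift] xs(4) by simp
    have "((\<lambda>h. \<rho> 1 h / (norm h)\<^sup>2 * (norm h)\<^sup>2) \<longlongrightarrow> 0 * (norm (0::real^'d))\<^sup>2) (at 0)"
      by (intro tendsto_intros \<rho>) simp
    then have 3: "((\<lambda>h. \<rho> 1 h / (norm h)\<^sup>2 * (norm h)\<^sup>2) \<longlongrightarrow> 0) (at 0)" by simp
    have "((\<lambda>h. 2 * (real_of_ereal (\<Phi> (G (xs + h)) ls 1) - g (xs + h)
        - \<rho> 1 h / (norm h)\<^sup>2 * (norm h)\<^sup>2)) \<longlongrightarrow> 2 * (0 - 0 - 0)) (at 0)"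
      by (intro tendsto_intros 1 2 3)
    moreover have "\<forall>\<^sub>F h in at 0. 2 * (real_of_ereal (\<Phi> (G (xs + h)) ls 1) - g (xs + h)
        - \<rho> 1 h / (norm h)\<^sup>2 * (norm h)\<^sup>2) = \<omega> 1 h"
      using \<Phi>_eq[OF zero_less_one] unfolding eventually_at_filter
      by eventually_elim simp
    ultimately show ?thesis by (simp add: tendsto_cong)
  qed
  then obtain B where B: "\<And>u. norm u = 1 \<Longrightarrow> B \<le> \<omega> 1 u"
    using pos_homogeneous2_bounded_below[OF \<omega>(1)[OF zero_less_one]] by blast

  have "\<exists>c\<ge>1. \<exists>\<delta>>0. \<forall>h. h \<noteq> 0 \<longrightarrow> xs + h \<in> A \<longrightarrow> norm h < \<delta> \<longrightarrow>
      Q xs \<le> Q (xs + h) + \<omega> c h / 2 + \<rho> c h"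
  proof (rule ccontr)
    assume "\<not> ?thesis"
    then have "\<exists>h. h \<noteq> 0 \<and> xs + h \<in> A \<and> norm h < \<delta> \<and> Q (xs + h) + \<omega> c h / 2 + \<rho> c h < Q xs"
      if "c \<ge> 1" "\<delta> > 0" for c \<delta>
      using that by (meson not_le)
    note violated = this[unfolded Q_def]
    have below: "B \<le> \<omega> c u" if "c \<ge> 1" "norm u = 1" for c u
      using B[OF that(2)] \<omega>_mono[OF that] by linarith
    obtain u hs cs where u: "u \<in> contingent_cone A xs" "norm u = 1" "hs \<longlonglongrightarrow> u"
      "filterlim cs at_top sequentially" "ereal B \<le> limsup (\<lambda>n. ereal (\<omega> (cs n) (hs n)))"
      and upper: "\<And>\<alpha>. (\<And>k. \<alpha> k \<ge> 0) \<Longrightarrow> (\<And>k. q k xs \<noteq> Q xs \<Longrightarrow> \<alpha> k = 0) \<Longrightarrow> sum \<alpha> I = 1 \<Longrightarrow>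
        (\<And>h. xs + h \<in> A \<Longrightarrow> 0 \<le> blinfun_apply (deriv1 (P \<alpha>) xs) h) \<Longrightarrow>
        limsup (\<lambda>n. ereal (\<omega> (cs n) (hs n))) \<le> ereal (- deriv2 (P \<alpha>) xs u u)"
      and descent: "\<And>k. k \<in> I \<Longrightarrow> q k xs = Q xs \<Longrightarrow> blinfun_apply (deriv1 (q k) xs) u \<le> 0"
      unfolding P_def[abs_def] Q_def
      by (rule violating_directions[where q = q and \<omega> = \<omega> and \<rho> = \<rho> and B = B, OF I A(2) xs(1)])
        (assumption | rule q2 \<omega>(1) below \<rho> violated | blast)+
    define l where "l = limsup (\<lambda>n. ereal (\<omega> (cs n) (hs n)))"
    have l_le: "l \<le> ereal (- deriv2 (\<lambda>z. real_of_ereal (lagrangian0 m f G z \<mu>s \<alpha>)) xs u u)"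
      if \<alpha>: "\<alpha> \<in> objective_multipliers m f G A xs \<mu>s" for \<alpha>
    proof -
      have sum1: "sum \<alpha> {1..m} = 1" using \<alpha> by (simp add: objective_multipliers_def)
      have "l \<le> ereal (- deriv2 (P \<alpha>) xs u u)"
        unfolding l_def
      proof (rule upper)
        show "0 \<le> blinfun_apply (deriv1 (P \<alpha>) xs) h" if "xs + h \<in> A" for h
          using \<alpha> convex_diff_in_contingent_cone[OF A(2) xs(1) that]
          by (auto simp: objective_multipliers_def lagr0(1)[OF sum1])
      qed (use \<alpha> sum1 in \<open>auto simp: objective_multipliers_def active I_def\<close>)
      then show ?thesis by (simp add: lagr0(2)[OF sum1])
    qed
    \<comment> \<open>Bounded below by \<open>B\<close>, and above by the value at any one
      multiplier.\<close>
    then have "\<bar>l\<bar> \<noteq> \<infinity>"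
      using multiplier_ex u(5) unfolding l_def[symmetric] by (cases l) auto
    then obtain l' where l': "l = ereal l'" by auto
    have crit: "u \<in> critical_cone G A K xs \<mu>s" "- support_fun \<mu>s (curvature_set G K xs u) \<le> ereal l'"
      using \<omega>(3)[OF u(1,3,4)] \<open>\<bar>l\<bar> \<noteq> \<infinity>\<close> unfolding l_def[symmetric] l' by auto
    obtain d where d: "d \<ge> 0"
      "has_directional_deriv (\<lambda>z. lagrangian (max_fun m f) G z \<mu>s) xs u d"
      using kkt_dir[OF u(1)] by blast
    from directional_deriv_of_Max[OF I q_deriv lagr d(2)] obtain k where
      k: "k \<in> I" "q k xs = Q xs" "d = ereal (blinfun_apply (deriv1 (q k) xs) u)"
      unfolding Q_def by blast
    \<comment> \<open>KKT gives one sign and the violating sequence the other, so \<open>u\<close>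
      is a direction at which the second order condition applies.\<close>
    then have "d = 0" using descent[OF k(1,2)] d(1) by simp
    have "(SUP \<alpha>\<in>objective_multipliers m f G A xs \<mu>s.
        ereal (deriv2 (\<lambda>z. real_of_ereal (lagrangian0 m f G z \<mu>s \<alpha>)) xs u u)) \<le> ereal (- l')"
    proof (rule SUP_least)
      fix \<alpha> assume "\<alpha> \<in> objective_multipliers m f G A xs \<mu>s"
      from l_le[OF this] show "ereal (deriv2 (\<lambda>z. real_of_ereal (lagrangian0 m f G z \<mu>s \<alpha>)) xs u u)
          \<le> ereal (- l')" by (simp add: l')
    qed
    \<comment> \<open>Both summands have real upper bounds, \<open>- l'\<close> and
      \<open>l'\<close>, so the extended sum is at most 0.\<close>
    from add_mono[OF this crit(2)] have "(SUP \<alpha>\<in>objective_multipliers m f G A xs \<mu>s.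
        ereal (deriv2 (\<lambda>z. real_of_ereal (lagrangian0 m f G z \<mu>s \<alpha>)) xs u u))
        - support_fun \<mu>s (curvature_set G K xs u) \<le> 0"
      by (simp add: minus_ereal_def zero_ereal_def)
    moreover have "u \<noteq> 0" using u(2) by auto
    ultimately show False
      using sosc crit(1) d(2) \<open>d = 0\<close> unfolding second_order_sufficient_def by force
  qed
  then obtain c \<delta> where c: "c \<ge> 1" "\<delta> > 0" and growth: "\<And>h. h \<noteq> 0 \<Longrightarrow> xs + h \<in> A \<Longrightarrow>
      norm h < \<delta> \<Longrightarrow> Q xs \<le> Q (xs + h) + \<omega> c h / 2 + \<rho> c h"
    by blast
  have c0: "c > 0" using c(1) by simp
  obtain \<delta>1 where \<delta>1: "\<delta>1 > 0" "\<And>z. dist z xs < \<delta>1 \<Longrightarrow> \<forall>k\<in>{1..m}. \<bar>f k z\<bar> \<noteq> \<infinity>"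
    using fin unfolding eventually_nhds_metric by blast
  obtain \<delta>2 where \<delta>2: "\<delta>2 > 0" "\<And>h. norm h < \<delta>2 \<Longrightarrow>
      \<Phi> (G (xs + h)) ls c = ereal (g (xs + h) + \<omega> c h / 2 + \<rho> c h)"
    using \<Phi>_eq[OF c0] unfolding eventually_nhds_metric dist_norm by auto
  \<comment> \<open>The three radii secure the growth inequality, finiteness of all
    \<open>f k\<close>, and the expansion at the single parameter \<open>c\<close>. Larger
    parameters follow by (A4) on the same ball.\<close>
  define U where "U = ball xs (min \<delta> (min \<delta>1 \<delta>2))"
  have lower: "max_fun m f xs \<le> max_fun m f x + \<Phi> (G x) ls c'" if x: "x \<in> U \<inter> A" and c': "c' \<ge> c" for x c'
  proof (cases "x = xs")
    case True
    then show ?thesis using \<Phi>_xs[of c'] c0 c' by simp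
  next
    case False
    define h where "h = x - xs"
    have h: "x = xs + h" "h \<noteq> 0" "xs + h \<in> A" "norm h < \<delta>" "norm h < \<delta>1" "norm h < \<delta>2"
      using x False by (auto simp: h_def U_def dist_norm norm_minus_commute)
    have "R xs \<le> R (xs + h) + (g (xs + h) + \<omega> c h / 2 + \<rho> c h)"
      using growth[OF h(2-4)] xs(4) by (simp add: Q_eq)
    then have "max_fun m f xs \<le> max_fun m f x + \<Phi> (G x) ls c"
      using \<delta>1(2)[of x] h(5) by (simp add: F_eq fin_xs \<delta>2(2)[OF h(6)] h(1) dist_norm)
    also have "\<dots> \<le> max_fun m f x + \<Phi> (G x) ls c'"
      by (intro add_left_mono mono c0 c')
    finally show ?thesis .
  qed
  show ?thesis
    unfolding local_saddle_point_def aug_lagrangian_def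
  proof (intro conjI exI[of _ c] exI[of _ U] allI impI)
    fix c' assume c': "c' \<ge> c"
    then have "c' > 0" using c0 by simp
    have xs_eq: "max_fun m f xs + \<Phi> (G xs) ls c' = max_fun m f xs"
      by (simp add: \<Phi>_xs[OF \<open>c' > 0\<close>])
    show "max_fun m f xs + \<Phi> (G xs) ls c' < \<infinity>"
      unfolding xs_eq by (simp add: F_eq[OF fin_xs])
    show "(SUP l\<in>\<Lambda>. max_fun m f xs + \<Phi> (G xs) l c') \<le> max_fun m f xs + \<Phi> (G xs) ls c'"
      unfolding xs_eq
    proof (rule SUP_least)
      fix l assume "l \<in> \<Lambda>"
      from add_left_mono[OF A2[OF xs(2) this \<open>c' > 0\<close>], of "max_fun m f xs"]
      show "max_fun m f xs + \<Phi> (G xs) l c' \<le> max_fun m f xs" by simp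
    qed
    show "max_fun m f xs + \<Phi> (G xs) ls c' \<le> (INF x\<in>U \<inter> A. max_fun m f x + \<Phi> (G x) ls c')"
      unfolding xs_eq by (intro INF_greatest lower c')
  qed (use xs(1) ls(2) c0 c(2) \<delta>1(1) \<delta>2(1) in \<open>auto simp: U_def\<close>)
qed

end
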